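(* Fix a web CA rule $f$ that is either diagonal-compliant or wide-compliant. For each integer $L\ge 0$, start the CA from a uniformly random binary seed $\xi_0$ on $[0,L]$. Then there exist a random variable $R_L$ taking values in $[0,\infty]$ and a random ether $\eta_L$, both deterministic functions of the seed, such that: (1) $\mathbf P(R_L=\infty)\to 0$ as $L\to\infty$, and indeed the sequence $(R_L)_{L\ge 0}$ is tight; (2) on the event $R_L<\infty$, the configuration $\xi$ is a replicator of thickness $R_L+L$ and ether $\eta_L$; (3) furthermore, if any finite set of $0$s in $\xi_0$ are changed into $2$s, then (on the event $R_L<\infty$) the configuration started from the resulting seed is also a replicator of thickness $R_L+L$ and ether $\eta_L$, with the same $R_L$ and $\eta_L$.
   Context: All intervals are subsets of $\mathbb Z$. A (3-state, range-2) cellular automaton (CA) rule is a function $f:\{0,1,2\}^5\to\{0,1,2\}$; from $\xi_0\in\{0,1,2\}^{\mathbb Z}$ it evolves by $\xi_{t+1}(x)=f(\xi_t(x-2),\xi_t(x-1),\xi_t(x),\xi_t(x+1),\xi_t(x+2))$, $t=0,1,2,\dots$. Write $\xi(x,t)=\xi_t(x)$. A seed is an initial configuration with finite support. Let $\delta(a)=\mathbf 1[a=1]$. The rule $f$ is a web CA if $f(0,0,0,0,0)=0$ and $\delta(f(a,b,c,d,e))=\delta(b)+\delta(c)+\delta(d) \bmod 2$ for all $a,b,c,d,e\in\{0,1,2\}$. Below $a,b,c,d,e,a',b',c',d',e'\in\{0,1,2\}$ are arbitrary subject to $\delta(a)=\delta(a'),\dots,\delta(e)=\delta(e')$; put $\ell=\delta(a)+\delta(b)+\delta(c)\bmod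 2$ and $r=\delta(c)+\delta(d)+\delta(e)\bmod 2$. - $f$ is empty-compliant if always $f(a,b,c,d,e)=f(a',b,c,d,e')$. - $f$ is diagonal-compliant if always $f(a,b,c,d,e)=f(a',b,c',d,e')$. - $f$ is wide-compliant if it is empty-compliant and: $c=r=1$ implies $f(a,b,c,d,e)=f(a',b,c,d',e')$; and $c=\ell=1$ implies $f(a,b,c,d,e)=f(a',b',c,d,e')$. A uniformly random binary seed on $[0,L]$ is a $\xi_0$ where $\xi_0(x)$, $x\in[0,L]$, are independent taking values $0,1$ with probability $1/2$ each, and $\xi_0(x)=0$ for $x\notin[0,L]$. The 1 Or 3 CA is the binary CA $\lambda_{t+1}(x)=\lambda_t(x-1)+\lambda_t(x)+\lambda_t(x+1)\bmod 2$. Let $\lambda^\bullet$ be this CA started from a single $1$ at the origin, $\Lambda=\{(x,t):\lambda^\bullet(x,t)=1\}$, and let $\Lambda(r)\subset\mathbb Z^2$ be the set of points at $\ell^1$-distance at most $r$ from $\Lambda$. An ether is an element $\eta\in\{0,2\}^{\mathbb Z^2}$ that is periodic in both coordinates. Two ethers are equivalent if one is a translate of the other by an element of $\mathbb Z^2$. A set $K\subseteq\mathbb Z\times[0,\infty)$ is filled with $\eta$ (in a configuration $\xi$) if $\xi$ agrees on $K$ with some ether equivalent to $\eta$. A configuration $\xi$ (or its seed $\xi_0$) is a replicator of thickness $r$ and ether $\eta$ if each bounded connected component of $\mathbb Z^2\setminus\Lambda(r)$ (nearest-neighbour adjacency) is filled with $\eta$. Tightness of $(R_L)$ means $\lim_{\rho\to\infty}\limsup_{L\to\infty}\mathbf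 P(R_L>\rho)=0$. *)

theory Defs
  imports "HOL-Probability.Probability"
begin

text \<open>
  The numeral type \<open>3\<close> supplies the three states; only its elements 0, 1, 2 matter,
  its arithmetic modulo 3 is never used.
\<close>
type_synonym state = 3

type_synonym rule = "state \<Rightarrow> state \<Rightarrow> state \<Rightarrow> state \<Rightarrow> state \<Rightarrow> state"

primrec evolve :: "rule \<Rightarrow> (int \<Rightarrow> state) \<Rightarrow> nat \<Rightarrow> int \<Rightarrow> state" where
  "evolve f \<xi>\<^sub>0 0 = \<xi>\<^sub>0"
| "evolve f \<xi>\<^sub>0 (Suc t) =
    (\<lambda>x. f (evolve f \<xi>\<^sub>0 t (x - 2)) (evolve f \<xi>\<^sub>0 t (x - 1)) (evolve f \<xi>\<^sub>0 t x)
           (evolve f \<xi>\<^sub>0 t (x + 1)) (evolve f \<xi>\<^sub>0 t (x + 2)))"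

definition \<delta> :: "state \<Rightarrow> nat" where
  "\<delta> a = of_bool (a = 1)"

definition web_CA :: "rule \<Rightarrow> bool" where
  "web_CA f \<longleftrightarrow> f 0 0 0 0 0 = 0 \<and>
    (\<forall>a b c d e. \<delta> (f a b c d e) = (\<delta> b + \<delta> c + \<delta> d) mod 2)"

definition empty_compliant :: "rule \<Rightarrow> bool" where
  "empty_compliant f \<longleftrightarrow>
    (\<forall>a b c d e a' e'. \<delta> a = \<delta> a' \<and> \<delta> e = \<delta> e' \<longrightarrow> f a b c d e = f a' b c d e')"

definition diagonal_compliant :: "rule \<Rightarrow> bool" where
  "diagonal_compliant f \<longleftrightarrow>
    (\<forall>a b c d e a' c' e'. \<delta> a = \<delta> a' \<and> \<delta> c = \<delta> c' \<and> \<delta> e = \<delta> e' \<longrightarrow>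
      f a b c d e = f a' b c' d e')"

definition wide_compliant :: "rule \<Rightarrow> bool" where
  "wide_compliant f \<longleftrightarrow> empty_compliant f \<and>
    (\<forall>a b c d e a' b' d' e'.
      \<delta> a = \<delta> a' \<and> \<delta> b = \<delta> b' \<and> \<delta> d = \<delta> d' \<and> \<delta> e = \<delta> e' \<longrightarrow>
        (c = 1 \<and> (\<delta> c + \<delta> d + \<delta> e) mod 2 = 1 \<longrightarrow> f a b c d e = f a' b c d' e') \<and>
        (c = 1 \<and> (\<delta> a + \<delta> b + \<delta> c) mod 2 = 1 \<longrightarrow> f a b c d e = f a' b' c d e'))"

text \<open>\<open>Pi_pmf\<close> makes the coordinates in \<open>{0..L}\<close> independent and fixes all others to 0.\<close>
definition random_binary_seed :: "nat \<Rightarrow> (int \<Rightarrow> state) pmf" where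
  "random_binary_seed L = Pi_pmf {0..int L} 0 (\<lambda>_. pmf_of_set {0, 1})"

primrec one_or_three :: "(int \<Rightarrow> nat) \<Rightarrow> nat \<Rightarrow> int \<Rightarrow> nat" where
  "one_or_three l\<^sub>0 0 = l\<^sub>0"
| "one_or_three l\<^sub>0 (Suc t) =
    (\<lambda>x. (one_or_three l\<^sub>0 t (x - 1) + one_or_three l\<^sub>0 t x + one_or_three l\<^sub>0 t (x + 1)) mod 2)"

text \<open>
  From here on, space-time points \<open>(x, t)\<close> live in \<open>\<int>\<^sup>2\<close>, so times are integers
  and may be negative.
\<close>

definition \<Lambda> :: "(int \<times> int) set" where
  "\<Lambda> = {(x, int t) | x t. one_or_three (\<lambda>y. of_bool (y = 0)) t x = 1}"

definition l1_dist :: "int \<times> int \<Rightarrow> int \<times> int \<Rightarrow> int" where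
  "l1_dist z w = \<bar>fst z - fst w\<bar> + \<bar>snd z - snd w\<bar>"

definition \<Lambda>_nbhd :: "real \<Rightarrow> (int \<times> int) set" where
  "\<Lambda>_nbhd r = {z. \<exists>w\<in>\<Lambda>. real_of_int (l1_dist z w) \<le> r}"

definition nearest_neighbour :: "((int \<times> int) \<times> (int \<times> int)) set" where
  "nearest_neighbour = {(z, w). l1_dist z w = 1}"

text \<open>Connected components of the subgraph induced by \<open>S\<close>, as classes under path-reachability in \<open>S\<close>.\<close>
definition nn_components :: "(int \<times> int) set \<Rightarrow> (int \<times> int) set set" where
  "nn_components S = S // (nearest_neighbour \<inter> S \<times> S)\<^sup>*"

definition bounded_lattice_set :: "(int \<times> int) set \<Rightarrow> bool" where
  "bounded_lattice_set K \<longleftrightarrow> (\<exists>B. \<forall>z\<in>K. l1_dist z (0, 0) \<le> B)"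

definition ether :: "(int \<times> int \<Rightarrow> state) \<Rightarrow> bool" where
  "ether \<eta> \<longleftrightarrow> range \<eta> \<subseteq> {0, 2} \<and>
    (\<exists>p>0. \<forall>x t. \<eta> (x + p, t) = \<eta> (x, t)) \<and>
    (\<exists>q>0. \<forall>x t. \<eta> (x, t + q) = \<eta> (x, t))"

definition ether_equiv :: "(int \<times> int \<Rightarrow> state) \<Rightarrow> (int \<times> int \<Rightarrow> state) \<Rightarrow> bool" where
  "ether_equiv \<eta> \<eta>' \<longleftrightarrow> (\<exists>u v. \<forall>x t. \<eta>' (x, t) = \<eta> (x + u, t + v))"

text \<open>Being filled is defined only for subsets of the half-plane of nonnegative times.\<close>
definition filled :: "(nat \<Rightarrow> int \<Rightarrow> state) \<Rightarrow> (int \<times> int \<Rightarrow> state) \<Rightarrow> (int \<times> int) set \<Rightarrow> bool" where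
  "filled \<xi> \<eta> K \<longleftrightarrow> K \<subseteq> UNIV \<times> {0..} \<and>
    (\<exists>\<eta>'. ether \<eta>' \<and> ether_equiv \<eta> \<eta>' \<and> (\<forall>(x, t)\<in>K. \<xi> (nat t) x = \<eta>' (x, t)))"

definition replicator :: "real \<Rightarrow> (int \<times> int \<Rightarrow> state) \<Rightarrow> (nat \<Rightarrow> int \<Rightarrow> state) \<Rightarrow> bool" where
  "replicator r \<eta> \<xi> \<longleftrightarrow> ether \<eta> \<and>
    (\<forall>K \<in> nn_components (- \<Lambda>_nbhd r). bounded_lattice_set K \<longrightarrow> filled \<xi> \<eta> K)"

definition tight_seq :: "(nat \<Rightarrow> 'a pmf) \<Rightarrow> (nat \<Rightarrow> 'a \<Rightarrow> ennreal) \<Rightarrow> bool" where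
  "tight_seq P X \<longleftrightarrow>
    ((\<lambda>\<rho>::real. limsup (\<lambda>L. ereal (measure_pmf.prob (P L) {s. X L s > ennreal \<rho>}))) \<longlongrightarrow> 0) at_top"

end

theory Submission
  imports Defs
begin

text \<open>
  The 1s of the configuration follow the additive 1 Or 3 rule \<open>T\<close>. Let \<open>M = 2 ^ m\<close>. At times that are
  multiples of \<open>M\<close>, the 1s are copies of the seed placed at a dilated row of \<open>\<Lambda>\<close>; since the row of \<open>\<Lambda>\<close>
  immediately before a void is killed by \<open>1 + x + x\<^sup>2\<close> on the base of the void, it has the pattern 110110...
  there. Hence \<open>M\<close> steps before any void of size much larger than \<open>M\<close> the 1s form, up to translation,
  one and the same row of spatial period \<open>3 * M\<close>, any \<open>2 * M\<close> consecutive cells of which are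
  independent fair bits once \<open>2 * M \<le> L + 1\<close>.

  The difference between states 0 and 2 spreads only along paths of cells carrying no 1. The rightmost
  path with a given end has to satisfy additional constraints, and with these the expected
  number of paths of length \<open>n\<close> decays like \<open>(7/8) ^ n\<close>, both in the diagonal- and in the
  wide-compliant case. So with high probability no path survives the \<open>M\<close> steps,
  in which case the states at the base of every large void are determined by the 1s alone and, up to
  translation, are the same spatially periodic word. Within a void the rule acts as a map on a finite
  set of periodic words, whence the evolution there is eventually periodic in time.
\<close>

section \<open>The additive dynamics\<close>

definition T :: "(int \<Rightarrow> bool) \<Rightarrow> int \<Rightarrow> bool" where
  "T b x \<longleftrightarrow> (b (x - 1) \<noteq> (b x \<noteq> b (x + 1)))"

lemma T_Suc: "(T ^^ Suc n) b x \<longleftrightarrow> ((T ^^ n) b (x - 1) \<noteq> ((T ^^ n) b x \<noteq> (T ^^ n) b (x + 1)))"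
  by (simp add: T_def)

declare funpow.simps(2) [simp del]

lemma state_cases: "(a::state) = 0 \<or> a = 1 \<or> a = 2"
  using exhaust_3[of a] by auto

lemma state_distinct [simp]:
  "(0::state) \<noteq> 1" "(1::state) \<noteq> 0" "(0::state) \<noteq> 2" "(2::state) \<noteq> 0" "(1::state) \<noteq> 2" "(2::state) \<noteq> 1"
  by auto

lemma delta_eq_iff: "\<delta> a = \<delta> b \<longleftrightarrow> (a = 1 \<longleftrightarrow> b = 1)"
  by (auto simp: \<delta>_def)

lemma web_CA_eq_1_iff:
  assumes "web_CA f"
  shows "f a b c d e = 1 \<longleftrightarrow> ((b = 1) \<noteq> ((c = 1) \<noteq> (d = 1)))"
proof -
  have "\<delta> (f a b c d e) = (\<delta> b + \<delta> c + \<delta> d) mod 2"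
    using assms by (auto simp: web_CA_def)
  then show ?thesis
    by (cases "f a b c d e = 1"; cases "b = 1"; cases "c = 1"; cases "d = 1") (simp_all add: \<delta>_def)
qed

lemma evolve_eq_1_iff:
  assumes "web_CA f"
  shows "evolve f s t x = 1 \<longleftrightarrow> (T ^^ t) (\<lambda>y. s y = 1) x"
  by (induction t arbitrary: x) (auto simp: web_CA_eq_1_iff[OF assms] T_Suc)

lemma one_or_three_eq_1_iff:
  "one_or_three (\<lambda>y. of_bool (b y)) t x = of_bool ((T ^^ t) b x)"
  by (induction t arbitrary: x) (auto simp: T_Suc)

lemma Lambda_iff: "(x, int t) \<in> \<Lambda> \<longleftrightarrow> (T ^^ t) (\<lambda>y. y = 0) x"
  by (auto simp: \<Lambda>_def one_or_three_eq_1_iff)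

lemma T_local:
  assumes "\<And>z. y - int n \<le> z \<Longrightarrow> z \<le> y + int n \<Longrightarrow> b z = b' z"
  shows "(T ^^ n) b y = (T ^^ n) b' y"
  using assms
proof (induction n arbitrary: y)
  case (Suc n)
  have "(T ^^ n) b z = (T ^^ n) b' z" if "z \<in> {y - 1..y + 1}" for z
    by (rule Suc.IH) (use Suc.prems that in auto)
  then show ?case by (simp add: T_Suc)
qed auto

lemma T_shift: "(T ^^ n) (\<lambda>x. b (x + u)) y = (T ^^ n) b (y + u)"
proof (induction n arbitrary: y)
  case (Suc n)
  have *: "y - 1 + u = y + u - 1" "y + 1 + u = y + u + 1" by auto
  show ?case by (simp only: T_Suc Suc *)
qed simp

lemma T_xor: "(T ^^ n) (\<lambda>x. b x \<noteq> b' x) y = ((T ^^ n) b y \<noteq> (T ^^ n) b' y)"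
  by (induction n arbitrary: y) (auto simp: T_Suc)

lemma T_zero: "(\<And>z. y - int n \<le> z \<Longrightarrow> z \<le> y + int n \<Longrightarrow> \<not> b z) \<Longrightarrow> \<not> (T ^^ n) b y"
proof -
  have *: "\<not> (T ^^ n) (\<lambda>_. False) y" by (induction n arbitrary: y) (auto simp: T_Suc)
  assume "\<And>z. y - int n \<le> z \<Longrightarrow> z \<le> y + int n \<Longrightarrow> \<not> b z"
  then have "(T ^^ n) b y = (T ^^ n) (\<lambda>_. False) y"
    by (intro T_local) auto
  with * show ?thesis by simp
qed

text \<open>The extreme coefficients of every power of \<open>1 + x + x^2\<close> are 1, so a lone 1
  at the far right end of the dependence window arrives uncancelled.\<close>

lemma T_right_end:
  assumes "\<And>z. y - int n \<le> z \<Longrightarrow> z < y + int n \<Longrightarrow> \<not> b z" "b (y + int n)"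
  shows "(T ^^ n) b y"
  using assms
proof (induction n arbitrary: y)
  case (Suc n)
  have "\<not> (T ^^ n) b (y - 1)" "\<not> (T ^^ n) b y"
    by (rule T_zero; use Suc.prems in auto)+
  moreover have "(T ^^ n) b (y + 1)"
    by (rule Suc.IH) (use Suc.prems in \<open>auto simp: algebra_simps\<close>)
  ultimately show ?case by (simp add: T_Suc)
qed auto

lemma T_left_end:
  assumes "\<And>z. y - int n < z \<Longrightarrow> z \<le> y + int n \<Longrightarrow> \<not> b z" "b (y - int n)"
  shows "(T ^^ n) b y"
  using assms
proof (induction n arbitrary: y)
  case (Suc n)
  have "\<not> (T ^^ n) b (y + 1)" "\<not> (T ^^ n) b y"
    by (rule T_zero; use Suc.prems in auto)+
  moreover have "(T ^^ n) b (y - 1)"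
    by (rule Suc.IH) (use Suc.prems in \<open>auto simp: algebra_simps\<close>)
  ultimately show ?case by (simp add: T_Suc)
qed auto

text \<open>Squaring is additive in characteristic 2: when \<open>2 ^ m\<close> steps are applied
  twice, the mixed terms occur in pairs and cancel, which leaves three terms at doubled
  distance.\<close>

lemma T_pow2:
  "(T ^^ (2 ^ m)) b x \<longleftrightarrow> (b (x - 2 ^ m) \<noteq> (b x \<noteq> b (x + 2 ^ m)))"
proof (induction m arbitrary: b x)
  case (Suc m)
  have "(T ^^ (2 ^ Suc m)) b x = (T ^^ (2 ^ m)) ((T ^^ (2 ^ m)) b) x"
    by (simp add: funpow_add mult_2)
  then show ?case by (simp add: Suc) (auto simp: algebra_simps)
qed (simp add: T_Suc[where n = 0, simplified] numeral_eq_Suc)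

text \<open>Self-similarity of \<Lambda>: by \<open>T_pow2\<close>, a block of \<open>2 ^ m\<close>
  steps acts on the multiples of \<open>2 ^ m\<close> like a single step of \<open>T\<close> and
  never leaves that sublattice.\<close>

lemma T_dilate:
  "(T ^^ (q * 2 ^ m)) (\<lambda>y. y = 0) x \<longleftrightarrow> 2 ^ m dvd x \<and> (T ^^ q) (\<lambda>y. y = 0) (x div 2 ^ m)"
proof (induction q arbitrary: x)
  case (Suc q)
  have "(T ^^ (Suc q * 2 ^ m)) (\<lambda>y. y = 0) x
      = (T ^^ (2 ^ m)) ((T ^^ (q * 2 ^ m)) (\<lambda>y. y = 0)) x"
    by (simp add: funpow_add)
  also have "\<dots> \<longleftrightarrow> 2 ^ m dvd x \<and> (T ^^ Suc q) (\<lambda>y. y = 0) (x div 2 ^ m)"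
  proof (cases "2 ^ m dvd x")
    case True
    then obtain k where "x = 2 ^ m * k" by blast
    then have "x - 2 ^ m = 2 ^ m * (k - 1)" "x + 2 ^ m = 2 ^ m * (k + 1)" "x = 2 ^ m * k"
      by (auto simp: algebra_simps)
    then show ?thesis by (simp add: T_pow2 Suc T_Suc)
  next
    case False
    then have "\<not> 2 ^ m dvd x - 2 ^ m" "\<not> 2 ^ m dvd x + 2 ^ m"
      by (simp_all add: dvd_diff_left_iff)
    with False show ?thesis by (simp add: T_pow2 Suc)
  qed
  finally show ?case by simp
qed auto

section \<open>Convolution with the seed over GF(2)\<close>

definition superpose :: "nat \<Rightarrow> (int \<Rightarrow> bool) \<Rightarrow> (int \<Rightarrow> bool) \<Rightarrow> int \<Rightarrow> bool" where
  "superpose L E b x \<longleftrightarrow> odd (\<Sum>y\<in>{0..int L}. of_bool (b y \<and> E (x - y)) :: nat)"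

lemma odd_sum_xor:
  fixes P Q :: "'a \<Rightarrow> bool"
  assumes "finite A"
  shows "odd (\<Sum>y\<in>A. of_bool (P y \<noteq> Q y) :: nat)
    \<longleftrightarrow> (odd (\<Sum>y\<in>A. of_bool (P y) :: nat) \<noteq> odd (\<Sum>y\<in>A. of_bool (Q y) :: nat))"
  using assms
proof (induction A rule: finite_induct)
  case (insert x A)
  then show ?case
    by (cases "P x"; cases "Q x") (simp_all del: sum_of_bool_eq)
qed simp

lemma superpose_xor_left:
  "superpose L (\<lambda>z. E z \<noteq> E' z) b x = (superpose L E b x \<noteq> superpose L E' b x)"
proof -
  have "(b y \<and> E z \<noteq> E' z) = ((b y \<and> E z) \<noteq> (b y \<and> E' z))" for y z by auto
  then show ?thesis
    by (simp only: superpose_def odd_sum_xor[OF finite_atLeastAtMost_int])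
qed

lemma superpose_xor_right:
  "superpose L E (\<lambda>z. b z \<noteq> b' z) x = (superpose L E b x \<noteq> superpose L E b' x)"
proof -
  have "((b y \<noteq> b' y) \<and> E z) = ((b y \<and> E z) \<noteq> (b' y \<and> E z))" for y z by auto
  then show ?thesis
    by (simp only: superpose_def odd_sum_xor[OF finite_atLeastAtMost_int])
qed

lemma superpose_shift: "superpose L (\<lambda>z. E (z + u)) b x = superpose L E b (x + u)"
  by (simp add: superpose_def algebra_simps)

lemma superpose_single:
  assumes "i \<in> {0..int L}"
  shows "superpose L E (\<lambda>z. z = i) x = E (x - i)"
proof -
  have "(\<Sum>y\<in>{0..int L}. of_bool (y = i \<and> E (x - y)) :: nat)
      = (\<Sum>y\<in>{0..int L}. if y = i then of_bool (E (x - i)) else 0)"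
    by (intro sum.cong) auto
  with assms show ?thesis by (simp add: superpose_def)
qed

text \<open>\<open>T\<close> is linear over GF(2) and commutes with translations, hence with
  convolution by the seed.\<close>

lemma T_superpose: "(T ^^ n) (superpose L E b) x = superpose L ((T ^^ n) E) b x"
proof (induction n arbitrary: x)
  case (Suc n)
  have "(T ^^ Suc n) E = (\<lambda>x. (T ^^ n) E (x + - 1) \<noteq> ((T ^^ n) E x \<noteq> (T ^^ n) E (x + 1)))"
    by (rule ext) (simp add: T_Suc)
  then have "superpose L ((T ^^ Suc n) E) b x = (superpose L ((T ^^ n) E) b (x + - 1) \<noteq>
      (superpose L ((T ^^ n) E) b x \<noteq> superpose L ((T ^^ n) E) b (x + 1)))"
    by (simp only: superpose_xor_left superpose_shift)
  then show ?case
    by (simp only: Suc T_Suc[of n "superpose L E b"]) simp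
qed simp

lemma superpose_unit:
  assumes "\<And>x. b x \<Longrightarrow> x \<in> {0..int L}"
  shows "superpose L (\<lambda>z. z = 0) b x = b x"
proof -
  have "(\<Sum>y\<in>{0..int L}. of_bool (b y \<and> x - y = 0) :: nat)
      = (\<Sum>y\<in>{0..int L}. if y = x then of_bool (b x) else 0)"
    by (intro sum.cong) auto
  then show ?thesis using assms[of x] by (auto simp: superpose_def)
qed

lemma T_eq_superpose:
  assumes "\<And>x. b x \<Longrightarrow> x \<in> {0..int L}"
  shows "(T ^^ n) b x = superpose L ((T ^^ n) (\<lambda>z. z = 0)) b x"
proof -
  have "superpose L (\<lambda>z. z = 0) b = b"
    using superpose_unit[OF assms] by blast
  then show ?thesis
    by (metis T_superpose)
qed

section \<open>Influence paths\<close>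

text \<open>
  The flag \<open>dg\<close> selects diagonal-compliance (\<open>True\<close>) or wide-compliance (\<open>False\<close>). A step leaves a
  point carrying no 1 whose left and right neighbours carry a 1 iff \<open>w\<close> and \<open>p\<close>, respectively.
\<close>
definition right_ok :: "bool \<Rightarrow> bool \<Rightarrow> bool \<Rightarrow> bool" where
  "right_ok dg w p \<longleftrightarrow> dg \<or> w \<or> \<not> p"

definition left_ok :: "bool \<Rightarrow> bool \<Rightarrow> bool \<Rightarrow> bool" where
  "left_ok dg w p \<longleftrightarrow> dg \<or> p \<or> \<not> w"

primrec reach :: "bool \<Rightarrow> (int \<Rightarrow> bool) \<Rightarrow> nat \<Rightarrow> int \<Rightarrow> bool" where
  "reach dg b 0 y \<longleftrightarrow> \<not> b y"
| "reach dg b (Suc n) y \<longleftrightarrow> \<not> (T ^^ Suc n) b y \<and>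
    (reach dg b n (y - 1) \<and> right_ok dg ((T ^^ n) b (y - 2)) ((T ^^ n) b y) \<or>
     \<not> dg \<and> reach dg b n y \<or>
     reach dg b n (y + 1) \<and> left_ok dg ((T ^^ n) b y) ((T ^^ n) b (y + 2)))"

definition compliant :: "bool \<Rightarrow> rule \<Rightarrow> bool" where
  "compliant dg f \<longleftrightarrow> (if dg then diagonal_compliant f else wide_compliant f)"

lemma diagonal_compliantD:
  assumes "diagonal_compliant f" "(a = 1) = (a' = 1)" "(c = 1) = (c' = 1)" "(e = 1) = (e' = 1)"
  shows "f a b c d e = f a' b c' d e'"
  by (rule assms(1)[unfolded diagonal_compliant_def delta_eq_iff, rule_format]) (use assms in simp)

lemma empty_compliantD:
  assumes "empty_compliant f" "(a = 1) = (a' = 1)" "(e = 1) = (e' = 1)"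
  shows "f a b c d e = f a' b c d e'"
  by (rule assms(1)[unfolded empty_compliant_def delta_eq_iff, rule_format]) (use assms in simp)

lemma compliant_empty_compliant:
  assumes "compliant dg f"
  shows "empty_compliant f"
proof (cases dg)
  case True
  then have "diagonal_compliant f" using assms by (simp add: compliant_def)
  then show ?thesis
    unfolding empty_compliant_def delta_eq_iff by (intro allI impI diagonal_compliantD) auto
next
  case False
  then show ?thesis using assms by (simp add: compliant_def wide_compliant_def)
qed

text \<open>Both outputs have the same \<delta>, so they can differ only if neither is 1, which
  forces an even number of 1s among \<open>b\<close>, \<open>c\<close>, \<open>d\<close>. In the
  wide case a centre 1 then has a 1 on exactly one side. The differing neighbour is on the other
  side, and wide-compliance ignores it unless the cell beyond it carries a 1 as well.\<close>

lemma rule_disagreement: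
  assumes "web_CA f" "compliant dg f"
    and "(a = 1) = (a' = 1)" "(b = 1) = (b' = 1)" "(c = 1) = (c' = 1)" "(d = 1) = (d' = 1)"
      "(e = 1) = (e' = 1)"
    and neq: "f a b c d e \<noteq> f a' b' c' d' e'"
  shows "b \<noteq> b' \<and> right_ok dg (a = 1) (c = 1) \<or> \<not> dg \<and> c \<noteq> c' \<or>
    d \<noteq> d' \<and> left_ok dg (c = 1) (e = 1)"
proof (cases dg)
  case True
  then have "diagonal_compliant f" using assms(2) by (simp add: compliant_def)
  then have "b \<noteq> b' \<or> d \<noteq> d'"
    using diagonal_compliantD[of f a a' c c' e e' b d] assms(3-8) by blast
  with True show ?thesis by (auto simp: right_ok_def left_ok_def)
next
  case False
  then have wide: "wide_compliant f" using assms(2) by (simp add: compliant_def)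
  have empty: "f a b c d e = f a' b' c' d' e'" if "b = b'" "c = c'" "d = d'"
    using empty_compliantD[OF compliant_empty_compliant[OF assms(2)] assms(3,7)] that by simp
  have "\<not> (f a b c d e = 1 \<and> f a' b' c' d' e' = 1)"
    using neq by auto
  then have parity: "(b = 1) = ((c = 1) \<noteq> (d = 1))"
    using web_CA_eq_1_iff[OF assms(1)] assms(4-6) by blast
  show ?thesis
  proof (cases "c = 1")
    case c: True
    with assms have [simp]: "c' = 1" by simp
    show ?thesis
    proof (rule ccontr)
      assume neg: "\<not> ?thesis"
      from empty neq c have "b \<noteq> b' \<or> d \<noteq> d'" by auto
      then show False
      proof
        assume b: "b \<noteq> b'"
        with assms have b1: "b \<noteq> 1" by auto
        with parity c have d1: "d = 1" by auto
        with assms have d': "d = d'" by auto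
        from neg b c False have "a \<noteq> 1" by (auto simp: right_ok_def)
        then have "(\<delta> a + \<delta> b + \<delta> c) mod 2 = 1"
          using b1 c by (simp add: \<delta>_def)
        then have "f a b c d e = f a' b' c d e'"
          using wide[unfolded wide_compliant_def delta_eq_iff, THEN conjunct2, rule_format,
              of a a' b b' d d' e e' c, THEN conjunct2] assms(3-7) c by blast
        with neq d' c show False by simp
      next
        assume d: "d \<noteq> d'"
        with assms have d1: "d \<noteq> 1" by auto
        with parity c have b1: "b = 1" by auto
        with assms have b': "b = b'" by auto
        from neg d c False have "e \<noteq> 1" by (auto simp: left_ok_def)
        then have "(\<delta> c + \<delta> d + \<delta> e) mod 2 = 1"
          using d1 c by (simp add: \<delta>_def)
        then have "f a b c d e = f a' b c d' e'"
          using wide[unfolded wide_compliant_def delta_eq_iff, THEN conjunct2, rule_format,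
              of a a' b b' d d' e e' c, THEN conjunct1] assms(3-7) c by blast
        with neq b' c show False by simp
      qed
    qed
  next
    case c: False
    with empty neq False show ?thesis by (auto simp: right_ok_def left_ok_def)
  qed
qed

text \<open>A disagreement is traced back one step at a time by \<open>rule_disagreement\<close>. A
  margin of two cells per step keeps every neighbourhood read by the rule inside the region where
  the 1s are known.\<close>

lemma disagreement_reach:
  assumes "web_CA f" "compliant dg f"
    and "\<And>x. lo \<le> x \<Longrightarrow> x \<le> hi \<Longrightarrow> (s x = 1) = r x"
    and "\<And>x. lo \<le> x \<Longrightarrow> x \<le> hi \<Longrightarrow> (s' x = 1) = r x"
    and "lo + 2 * int n \<le> x" "x \<le> hi - 2 * int n" "evolve f s n x \<noteq> evolve f s' n x"
  shows "reach dg r n x"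
  using assms(5-7)
proof (induction n arbitrary: x)
  case 0
  then show ?case using assms(3,4)[of x] by auto
next
  case (Suc n)
  have one: "(evolve f s m y = 1) = (T ^^ m) r y" "(evolve f s' m y = 1) = (T ^^ m) r y"
    if "lo + int m \<le> y" "y \<le> hi - int m" for m y
    unfolding evolve_eq_1_iff[OF assms(1)]
    by (rule T_local; use that assms(3,4) in simp)+
  have same: "(evolve f s n y = 1) = (evolve f s' n y = 1)" if "x - 2 \<le> y" "y \<le> x + 2" for y
    using one[of n y] that Suc.prems(1,2) by simp
  have neq: "f (evolve f s n (x - 2)) (evolve f s n (x - 1)) (evolve f s n x)
           (evolve f s n (x + 1)) (evolve f s n (x + 2)) \<noteq>
    f (evolve f s' n (x - 2)) (evolve f s' n (x - 1)) (evolve f s' n x)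
           (evolve f s' n (x + 1)) (evolve f s' n (x + 2))"
    using Suc.prems(3) by simp
  have "evolve f s n (x - 1) \<noteq> evolve f s' n (x - 1) \<and>
      right_ok dg (evolve f s n (x - 2) = 1) (evolve f s n x = 1) \<or>
      \<not> dg \<and> evolve f s n x \<noteq> evolve f s' n x \<or>
      evolve f s n (x + 1) \<noteq> evolve f s' n (x + 1) \<and>
      left_ok dg (evolve f s n x = 1) (evolve f s n (x + 2) = 1)"
  proof -
    have s: "(evolve f s n (x - 2) = 1) = (evolve f s' n (x - 2) = 1)"
      "(evolve f s n (x - 1) = 1) = (evolve f s' n (x - 1) = 1)"
      "(evolve f s n x = 1) = (evolve f s' n x = 1)"
      "(evolve f s n (x + 1) = 1) = (evolve f s' n (x + 1) = 1)"
      "(evolve f s n (x + 2) = 1) = (evolve f s' n (x + 2) = 1)"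
      by (intro same; linarith)+
    note X = rule_disagreement[OF assms(1,2)]
    note Y = X[OF s]
    note Z = Y[OF neq]
    show ?thesis
      by (rule Z)
  qed
  moreover have "(evolve f s n (x - 2) = 1) = (T ^^ n) r (x - 2)"
    "(evolve f s n x = 1) = (T ^^ n) r x" "(evolve f s n (x + 2) = 1) = (T ^^ n) r (x + 2)"
    by (rule one; use Suc.prems(1,2) in simp)+
  ultimately have step: "evolve f s n (x - 1) \<noteq> evolve f s' n (x - 1) \<and>
      right_ok dg ((T ^^ n) r (x - 2)) ((T ^^ n) r x) \<or>
      \<not> dg \<and> evolve f s n x \<noteq> evolve f s' n x \<or>
      evolve f s n (x + 1) \<noteq> evolve f s' n (x + 1) \<and>
      left_ok dg ((T ^^ n) r x) ((T ^^ n) r (x + 2))"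
    by (simp only:)
  have IH: "reach dg r n y" if "evolve f s n y \<noteq> evolve f s' n y" "x - 1 \<le> y" "y \<le> x + 1" for y
    by (rule Suc.IH) (use Suc.prems that in auto)
  have "(evolve f s (Suc n) x = 1) = (T ^^ Suc n) r x"
    "(evolve f s' (Suc n) x = 1) = (T ^^ Suc n) r x"
    by (rule one; use Suc.prems in simp)+
  with Suc.prems(3) have "\<not> (T ^^ Suc n) r x" by metis
  moreover from step have "reach dg r n (x - 1) \<and> right_ok dg ((T ^^ n) r (x - 2)) ((T ^^ n) r x) \<or>
      \<not> dg \<and> reach dg r n x \<or> reach dg r n (x + 1) \<and> left_ok dg ((T ^^ n) r x) ((T ^^ n) r (x + 2))"
  proof (elim disjE conjE)
    assume "evolve f s n (x - 1) \<noteq> evolve f s' n (x - 1)"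
      and ok: "right_ok dg ((T ^^ n) r (x - 2)) ((T ^^ n) r x)"
    then have "reach dg r n (x - 1)" by (intro IH) auto
    with ok show ?thesis by blast
  next
    assume "evolve f s n x \<noteq> evolve f s' n x" and ok: "\<not> dg"
    then have "reach dg r n x" by (intro IH) auto
    with ok show ?thesis by blast
  next
    assume "evolve f s n (x + 1) \<noteq> evolve f s' n (x + 1)"
      and ok: "left_ok dg ((T ^^ n) r x) ((T ^^ n) r (x + 2))"
    then have "reach dg r n (x + 1)" by (intro IH) auto
    with ok show ?thesis by blast
  qed
  ultimately show ?case unfolding reach.simps by blast
qed

text \<open>
  Counts the influence paths that can be rightmost among those with the same end, by the type
  \<open>k\<close> of the last step: \<open>True\<close> for a step to the right (or no step at all). If the previous
  step was not to the right, then a next step straight up or to the right is rightmost only if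
  the right neighbour carries a 1, for otherwise the path could be rerouted through it.
\<close>
primrec paths :: "bool \<Rightarrow> (int \<Rightarrow> bool) \<Rightarrow> nat \<Rightarrow> bool \<Rightarrow> int \<Rightarrow> nat" where
  "paths dg b 0 k y = of_bool (k \<and> \<not> b y)"
| "paths dg b (Suc n) k y = of_bool (\<not> (T ^^ Suc n) b y) *
    (if k then of_bool (right_ok dg ((T ^^ n) b (y - 2)) ((T ^^ n) b y)) *
       (paths dg b n True (y - 1) + of_bool ((T ^^ n) b y) * paths dg b n False (y - 1))
     else of_bool (\<not> dg) * (paths dg b n True y + of_bool ((T ^^ n) b (y + 1)) * paths dg b n False y) +
       of_bool (left_ok dg ((T ^^ n) b y) ((T ^^ n) b (y + 2))) *
       (paths dg b n True (y + 1) + paths dg b n False (y + 1)))"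

lemma paths_zero: "(T ^^ n) b y \<Longrightarrow> paths dg b n k y = 0"
  by (cases n) auto

lemma paths_reach: "paths dg b n k y \<noteq> 0 \<Longrightarrow> reach dg b n y"
  by (induction n arbitrary: k y) (auto split: if_splits simp: of_bool_def)

text \<open>The last step is chosen greedily: from the right neighbour if possible, otherwise from
  the same cell, otherwise from the left neighbour. If the constraint built into
  \<open>paths\<close> failed, a detour through a cell further right would contradict this
  choice.\<close>

lemma reach_paths:
  assumes "reach dg b n y"
  shows "paths dg b n True y + paths dg b n False y > 0"
  using assms
proof (induction n arbitrary: y)
  case 0
  then show ?case by simp
next
  case (Suc n)
  let ?c = "(T ^^ n) b"
  have y0: "\<not> (T ^^ Suc n) b y" using Suc.prems by simp
  have zero: "\<not> ?c z" if "reach dg b n z" for z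
    using that by (cases n) auto
  \<comment> \<open>Diagonal case: the last step came from \<open>z + 1\<close> and could have gone
    to \<open>z + 2\<close> instead. Wide case: it came from \<open>z\<close> or
    \<open>z + 1\<close>, and either could have moved to \<open>z + 1\<close>.\<close>
  have reroute: "if dg then (\<not> (T ^^ n) b (z + 2) \<longrightarrow> reach dg b n (z + 2)) else reach dg b n (z + 1)"
    if "paths dg b n False z \<noteq> 0" "\<not> ?c (z + 1)" for z
  proof (cases n)
    case 0
    with that show ?thesis by simp
  next
    case (Suc m)
    from that(1) have *: "\<not> dg \<and> reach dg b m z \<or> reach dg b m (z + 1)"
    proof (rule contrapos_np)
      assume "\<not> (\<not> dg \<and> reach dg b m z \<or> reach dg b m (z + 1))"
      then have "\<not> dg \<Longrightarrow> paths dg b m k z = 0" "paths dg b m k (z + 1) = 0" for k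
        using paths_reach by blast+
      then show "paths dg b n False z = 0" by (cases dg) (simp_all add: Suc)
    qed
    have z0: "\<not> ?c z" using that(1) paths_zero[of n b z dg False] by auto
    show ?thesis
    proof (cases dg)
      case True
      with * show ?thesis by (simp add: Suc right_ok_def add.commute)
    next
      case False
      have zm: "\<not> (T ^^ m) b x" if "reach dg b m x" for x
        using that by (cases m) auto
      have "reach dg b n (z + 1)"
      proof (cases "reach dg b m (z + 1)")
        case True
        with False that(2) show ?thesis by (simp add: Suc)
      next
        case nz: False
        with * have z: "reach dg b m z" by blast
        \<comment> \<open>The cell \<open>z\<close> carries no 1 at time \<open>m\<close> nor at the
          next time, so its two neighbours at time \<open>m\<close> agree.\<close>
        have "right_ok dg ((T ^^ m) b (z - 1)) ((T ^^ m) b (z + 1))"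
          using z0 zm[OF z] by (auto simp: right_ok_def Suc T_Suc)
        with z that(2) show ?thesis by (simp add: Suc add.commute)
      qed
      with False show ?thesis by simp
    qed
  qed
  show ?case
  proof (cases "reach dg b n (y + 1) \<and> left_ok dg (?c y) (?c (y + 2))")
    case True
    with Suc.IH[of "y + 1"] y0 show ?thesis by auto
  next
    case not_left: False
    show ?thesis
    proof (cases "\<not> dg \<and> reach dg b n y")
      case stay: True
      then have cy: "\<not> ?c y" using zero by blast
      have "?c (y + 1)" if "paths dg b n False y \<noteq> 0"
        using reroute[OF that] stay not_left cy by (auto simp: left_ok_def)
      with Suc.IH[of y] stay y0 show ?thesis
        by (cases "paths dg b n False y = 0") auto
    next
      case not_stay: False
      with not_left Suc.prems have right: "reach dg b n (y - 1)" "right_ok dg (?c (y - 2)) (?c y)"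
        by auto
      have "?c y" if "paths dg b n False (y - 1) \<noteq> 0"
      proof (rule ccontr)
        assume cy: "\<not> ?c y"
        with reroute[OF that] not_stay
        have "dg" "\<not> ?c (y + 1) \<Longrightarrow> reach dg b n (y + 1)" by (auto split: if_splits simp: add.commute)
        \<comment> \<open>There is no 1 at \<open>y - 1\<close> or \<open>y\<close>, nor at
          \<open>y\<close> one step later, so the additive rule leaves none for
          \<open>y + 1\<close>.\<close>
        moreover have "\<not> ?c (y + 1)"
          using y0 cy zero[OF right(1)] by (simp add: T_Suc)
        ultimately show False using not_left by (auto simp: left_ok_def)
      qed
      with Suc.IH[OF right(1)] right(2) y0 show ?thesis
        by (cases "paths dg b n False (y - 1) = 0") auto
    qed
  qed
qed

text \<open>The window exceeds that of \<open>T_local\<close> by one cell on each side, because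
  \<open>right_ok\<close> and \<open>left_ok\<close> inspect cells at distance 2 one step
  earlier.\<close>

lemma paths_local:
  assumes "\<And>z. y - int n - 1 \<le> z \<Longrightarrow> z \<le> y + int n + 1 \<Longrightarrow> b z = b' z"
  shows "paths dg b n k y = paths dg b' n k y"
  using assms
proof (induction n arbitrary: k y)
  case 0
  then show ?case by simp
next
  case (Suc n)
  have "(T ^^ Suc n) b y = (T ^^ Suc n) b' y"
    by (rule T_local) (use Suc.prems in auto)
  moreover have "(T ^^ n) b z = (T ^^ n) b' z" if "z \<in> {y - 2..y + 2}" for z
    by (rule T_local) (use Suc.prems that in auto)
  moreover have "paths dg b n k z = paths dg b' n k z" if "z \<in> {y - 1..y + 1}" for z k
    by (rule Suc.IH) (use Suc.prems that in auto)
  ultimately show ?case by simp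
qed

lemma paths_shift: "paths dg (\<lambda>x. b (x + u)) n k y = paths dg b n k (y + u)"
proof (induction n arbitrary: k y)
  case (Suc n)
  have *: "y - 1 + u = y + u - 1" "y + 1 + u = y + u + 1" "y - 2 + u = y + u - 2"
    "y + 2 + u = y + u + 2" by auto
  show ?case by (simp only: paths.simps T_shift Suc *)
qed simp

lemma periodic_mod:
  fixes F :: "int \<Rightarrow> 'a"
  assumes "\<And>y. F (y + P) = F y"
  shows "F (y mod P) = F y"
proof -
  have nat: "F (z + P * int k) = F z" for k z
  proof (induction k)
    case (Suc k)
    then show ?case using assms[of "z + P * int k"] by (simp add: algebra_simps)
  qed simp
  have "F (z + P * k) = F z" for k z
  proof (cases "k \<ge> 0")
    case True
    then show ?thesis using nat[of z "nat k"] by simp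
  next
    case False
    then show ?thesis using nat[of "z + P * k" "nat (- k)"] by simp
  qed
  from this[of "y mod P" "y div P"] show ?thesis by simp
qed

lemma sum_periodic:
  fixes F :: "int \<Rightarrow> nat"
  assumes "\<And>y. F (y + P) = F y" "P > 0"
  shows "(\<Sum>y\<in>{0..<P}. F (y + u)) = (\<Sum>y\<in>{0..<P}. F y)"
proof -
  have "(\<Sum>y\<in>{0..<P}. F (y + u)) = (\<Sum>y\<in>{0..<P}. F ((y + u) mod P))"
    by (simp add: periodic_mod[where F = F, OF assms(1)])
  also have "\<dots> = (\<Sum>y\<in>{0..<P}. F y)"
  proof (rule sum.reindex_bij_witness[where i = "\<lambda>y. (y - u) mod P" and j = "\<lambda>y. (y + u) mod P"])
  qed (use assms(2) in \<open>auto simp: mod_simps\<close>)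
  finally show ?thesis .
qed

text \<open>
  Found by solving for a (super-)eigenvector of the mean matrix of the resulting multitype
  branching process at growth rate 7/8.
\<close>
definition weight :: "bool \<Rightarrow> bool \<Rightarrow> bool \<Rightarrow> bool \<Rightarrow> nat" where
  "weight dg k w p =
    (if dg then if k then if w = p then 56 else 84
       else if p then if w then 56 else 84 else if w then 40 else 16
     else if k then if w = p then 8 else 4
       else if p then if w then 8 else 4 else 1)"

lemma weight_pos: "weight dg k w p \<ge> 1" and weight_le: "weight dg k w p \<le> 84"
  by (auto simp: weight_def)

text \<open>The finite check behind the decay rate, with \<open>NR\<close> and \<open>NL\<close> the
  numbers of paths of the two types ending at an empty cell with neighbours \<open>w\<close> and
  \<open>p\<close>. Each kind of step involves two fresh fair bits. For a sideways step, one decides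
  whether the target is empty and the other is its outer neighbour; for a step straight up, they
  determine the two new neighbours. Summing over both bits costs a factor 4, so
  \<open>28 = 4 * 7\<close> against 8 means growth by at most 7/8.\<close>

lemma weight_step:
  "8 * (of_bool (right_ok dg w p) * (NR + of_bool p * NL) *
          (weight dg True (w \<noteq> p) False + weight dg True (w \<noteq> p) True)
      + of_bool (\<not> dg \<and> w = p) * (NR + of_bool p * NL) *
          (weight dg False False False + weight dg False False True +
           weight dg False True False + weight dg False True True)
      + of_bool (left_ok dg w p) * (NR + NL) *
          (weight dg False False (w \<noteq> p) + weight dg False True (w \<noteq> p)))
    \<le> 28 * (NR * weight dg True w p + NL * weight dg False w p)"
  by (cases dg; cases w; cases p) (simp_all add: weight_def right_ok_def left_ok_def)

section \<open>Random rows\<close>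

definition comb :: "nat \<Rightarrow> int \<Rightarrow> bool" where
  "comb m z \<longleftrightarrow> 2 ^ m dvd z \<and> (z div 2 ^ m) mod 3 \<noteq> 2"

text \<open>
  Up to translation, this is what the 1s look like \<open>2 ^ m\<close> steps before the start of a large void.
\<close>
definition row :: "nat \<Rightarrow> nat \<Rightarrow> (int \<Rightarrow> bool) \<Rightarrow> int \<Rightarrow> bool" where
  "row m L b = superpose L (comb m) b"

definition seeds :: "nat \<Rightarrow> (int \<Rightarrow> bool) set" where
  "seeds L = {b. \<forall>x. b x \<longrightarrow> x \<in> {0..int L}}"

lemma finite_seeds: "finite (seeds L)"
proof -
  have "b \<in> (\<lambda>A x. x \<in> A) ` Pow {0..int L}" if "b \<in> seeds L" for b
    using that by (intro image_eqI[of _ _ "Collect b"]) (auto simp: seeds_def)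
  then show ?thesis
    by (intro finite_subset[of "seeds L" "(\<lambda>A x. x \<in> A) ` Pow {0..int L}"]) auto
qed

lemma comb_periodic: "comb m (z + 3 * 2 ^ m) = comb m z"
proof -
  have "(z + 3 * 2 ^ m) div 2 ^ m = z div 2 ^ m + 3" by simp
  then show ?thesis by (simp add: comb_def dvd_add_left_iff)
qed

lemma row_periodic: "row m L b (x + 3 * 2 ^ m) = row m L b x"
proof -
  have "superpose L (comb m) b (x + 3 * 2 ^ m) = superpose L (\<lambda>z. comb m (z + 3 * 2 ^ m)) b x"
    by (simp only: superpose_shift)
  then show ?thesis by (simp add: row_def comb_periodic)
qed

lemma T_row_periodic: "(T ^^ n) (row m L b) (x + 3 * 2 ^ m) = (T ^^ n) (row m L b) x"
  using T_shift[of n "row m L b" "3 * 2 ^ m" x] by (simp add: row_periodic)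

text \<open>Three cells at spacing \<open>2 ^ m\<close> meet \<open>comb\<close> in two 1s or in
  none, so the sum in \<open>T_pow2\<close> is even; superpositions inherit this.\<close>

lemma T_row_vanishes: "\<not> (T ^^ (2 ^ m)) (row m L b) x"
proof -
  have "\<not> (T ^^ (2 ^ m)) (comb m) z" for z
  proof (cases "2 ^ m dvd z")
    case True
    then obtain k where z: "z = 2 ^ m * k" by blast
    then have "z - 2 ^ m = 2 ^ m * (k - 1)" "z + 2 ^ m = 2 ^ m * (k + 1)"
      by (auto simp: algebra_simps)
    with z show ?thesis
      unfolding T_pow2 comb_def by simp presburger
  next
    case False
    then have "\<not> 2 ^ m dvd z - 2 ^ m" "\<not> 2 ^ m dvd z + 2 ^ m"
      by (simp_all add: dvd_diff_left_iff)
    with False show ?thesis by (simp add: T_pow2 comb_def)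
  qed
  then have "(T ^^ (2 ^ m)) (comb m) = (\<lambda>_. False)" by auto
  then show ?thesis
    by (simp add: row_def T_superpose) (simp add: superpose_def)
qed

lemma row_xor: "row m L (\<lambda>x. b x \<noteq> b' x) x = (row m L b x \<noteq> row m L b' x)"
  by (simp only: row_def superpose_xor_right)

text \<open>Single 1s of the seed at \<rho> and at \<open>\<rho> + 2 ^ m\<close> produce two of the
  three phases of 110110... on the residue class of \<rho>, and their sum is the third. The length
  assumption puts both positions into the seed interval.\<close>

lemma row_residue_class:
  assumes "2 * 2 ^ m \<le> int L + 1" "0 \<le> \<rho>" "\<rho> < 2 ^ m" "c \<in> {0, 1, 2}"
  obtains \<sigma> where "\<sigma> \<in> seeds L"
    "\<And>x. row m L \<sigma> x \<longleftrightarrow> 2 ^ m dvd x - \<rho> \<and> ((x - \<rho>) div 2 ^ m) mod 3 \<noteq> c"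
proof -
  let ?A = "\<lambda>x. x = \<rho>" and ?B = "\<lambda>x. x = \<rho> + 2 ^ m"
  have in_range: "\<rho> \<in> {0..int L}" "\<rho> + 2 ^ m \<in> {0..int L}" using assms by auto
  have A: "row m L ?A x \<longleftrightarrow> comb m (x - \<rho>)" and B: "row m L ?B x \<longleftrightarrow> comb m (x - \<rho> - 2 ^ m)" for x
    unfolding row_def using in_range by (simp_all add: superpose_single algebra_simps)
  have A': "row m L ?A x \<longleftrightarrow> 2 ^ m dvd x - \<rho> \<and> ((x - \<rho>) div 2 ^ m) mod 3 \<noteq> 2" for x
    by (simp add: A comb_def)
  have B': "row m L ?B x \<longleftrightarrow> 2 ^ m dvd x - \<rho> \<and> ((x - \<rho>) div 2 ^ m) mod 3 \<noteq> 0" for x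
  proof -
    have "(x - \<rho> - 2 ^ m) div 2 ^ m = (x - \<rho>) div 2 ^ m - 1"
      using div_mult_self1[of "2 ^ m" "x - \<rho>" "- 1 :: int"] by simp
    moreover have "(2::int) ^ m dvd x - \<rho> - 2 ^ m \<longleftrightarrow> 2 ^ m dvd x - \<rho>"
      by (simp add: dvd_diff_left_iff)
    moreover have "(k - 1) mod 3 \<noteq> 2 \<longleftrightarrow> k mod 3 \<noteq> 0" for k :: int by presburger
    ultimately show ?thesis by (simp add: B comb_def)
  qed
  have AB: "row m L (\<lambda>x. ?A x \<noteq> ?B x) x \<longleftrightarrow> 2 ^ m dvd x - \<rho> \<and> ((x - \<rho>) div 2 ^ m) mod 3 \<noteq> 1" for x
  proof -
    have *: "(k mod 3 \<noteq> 2) \<noteq> (k mod 3 \<noteq> 0) \<longleftrightarrow> k mod 3 \<noteq> 1" for k :: int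
    proof -
      have "k mod 3 = 0 \<or> k mod 3 = 1 \<or> k mod 3 = 2" by presburger
      then show ?thesis by auto
    qed
    show ?thesis
      unfolding row_xor A' B' using *[of "(x - \<rho>) div 2 ^ m"] by (cases "2 ^ m dvd x - \<rho>") simp_all
  qed
  have A_seed: "?A \<in> seeds L" and B_seed: "?B \<in> seeds L" and AB_seed: "(\<lambda>x. ?A x \<noteq> ?B x) \<in> seeds L"
    using in_range by (auto simp: seeds_def)
  from assms(4) consider "c = 0" | "c = 1" | "c = 2" by auto
  then show ?thesis
  proof cases
    case 1
    show ?thesis by (rule that[OF B_seed], unfold 1, rule B')
  next
    case 2
    show ?thesis by (rule that[OF AB_seed], unfold 2, rule AB)
  next
    case 3
    show ?thesis by (rule that[OF A_seed], unfold 3, rule A')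
  qed
qed

lemma xor_bij:
  assumes "\<sigma> \<in> seeds L"
  shows "bij_betw (\<lambda>b x. b x \<noteq> \<sigma> x) (seeds L) (seeds L)"
  using assms
  by (intro bij_betw_byWitness[where f' = "\<lambda>b x. b x \<noteq> \<sigma> x"]) (auto simp: seeds_def)

text \<open>
  Every cell of a row can be toggled by a measure-preserving change of the seed without affecting
  the preceding (or following) \<open>2 * 2 ^ m - 1\<close> cells; hence any \<open>2 * 2 ^ m\<close> consecutive
  cells are independent.
\<close>
lemma right_flip:
  assumes "2 * 2 ^ m \<le> int L + 1"
  obtains \<phi> where "bij_betw \<phi> (seeds L) (seeds L)"
    "\<And>b x. i - 2 * 2 ^ m < x \<Longrightarrow> x < i \<Longrightarrow> row m L (\<phi> b) x = row m L b x"
    "\<And>b n. n < 2 ^ m \<Longrightarrow> (T ^^ n) (row m L (\<phi> b)) (i - int n) = (\<not> (T ^^ n) (row m L b) (i - int n))"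
proof -
  define j where "j = i div 2 ^ m"
  \<comment> \<open>Leaving the coarse index \<open>j - 1\<close> empty makes \<open>j - 2\<close>
    the nearest 1 to the left, so the row of \<sigma> vanishes at the \<open>2 * 2 ^ m - 1\<close>
    cells before \<open>i\<close>.\<close>
  obtain \<sigma> where \<sigma>: "\<sigma> \<in> seeds L" and row: "\<And>x. row m L \<sigma> x \<longleftrightarrow>
      2 ^ m dvd x - i mod 2 ^ m \<and> ((x - i mod 2 ^ m) div 2 ^ m) mod 3 \<noteq> (j - 1) mod 3"
  proof (rule row_residue_class[OF assms, of "i mod 2 ^ m" "(j - 1) mod 3"])
    show "(j - 1) mod 3 \<in> {0, 1, 2}" by auto
  qed auto
  have i: "i - i mod 2 ^ m = 2 ^ m * j"
    by (simp add: j_def minus_mod_eq_mult_div)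
  have "j mod 3 \<noteq> (j - 1) mod 3" by presburger
  then have at: "row m L \<sigma> i" by (simp add: row i)
  have before: "\<not> row m L \<sigma> x" if "i - 2 * 2 ^ m < x" "x < i" for x
  proof
    assume r: "row m L \<sigma> x"
    then obtain k where k: "x - i mod 2 ^ m = 2 ^ m * k" using row by blast
    have "2 ^ m * k < 2 ^ m * j" "2 ^ m * (j - 2) < (2::int) ^ m * k"
      unfolding right_diff_distrib using that k i by linarith+
    then have "k < j" "j - 2 < k" by simp_all
    then have "k = j - 1" by simp
    with r k show False by (simp add: row)
  qed
  show thesis
  proof (rule that[OF xor_bij[OF \<sigma>]])
    fix b :: "int \<Rightarrow> bool" and x :: int and n :: nat
    show "row m L (\<lambda>x. b x \<noteq> \<sigma> x) x = row m L b x" if "i - 2 * 2 ^ m < x" "x < i" for x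
      using before[OF that] by (simp only: row_xor) simp
    assume n: "n < 2 ^ m"
    then have *: "int n < 2 ^ m" by (metis of_nat_less_iff of_nat_numeral of_nat_power)
    have "\<not> row m L \<sigma> z" if "i - int n - int n \<le> z" "z < i - int n + int n" for z
      by (rule before; use that * in linarith)
    then have "(T ^^ n) (row m L \<sigma>) (i - int n)"
      by (rule T_right_end) (use at in simp_all)
    moreover have "row m L (\<lambda>x. b x \<noteq> \<sigma> x) = (\<lambda>x. row m L b x \<noteq> row m L \<sigma> x)"
      by (rule ext) (rule row_xor)
    ultimately show "(T ^^ n) (row m L (\<lambda>x. b x \<noteq> \<sigma> x)) (i - int n) = (\<not> (T ^^ n) (row m L b) (i - int n))"
      by (simp only: T_xor) simp
  qed
qed

lemma left_flip:
  assumes "2 * 2 ^ m \<le> int L + 1"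
  obtains \<phi> where "bij_betw \<phi> (seeds L) (seeds L)"
    "\<And>b x. i < x \<Longrightarrow> x < i + 2 * 2 ^ m \<Longrightarrow> row m L (\<phi> b) x = row m L b x"
    "\<And>b n. n < 2 ^ m \<Longrightarrow> (T ^^ n) (row m L (\<phi> b)) (i + int n) = (\<not> (T ^^ n) (row m L b) (i + int n))"
proof -
  define j where "j = i div 2 ^ m"
  obtain \<sigma> where \<sigma>: "\<sigma> \<in> seeds L" and row: "\<And>x. row m L \<sigma> x \<longleftrightarrow>
      2 ^ m dvd x - i mod 2 ^ m \<and> ((x - i mod 2 ^ m) div 2 ^ m) mod 3 \<noteq> (j + 1) mod 3"
  proof (rule row_residue_class[OF assms, of "i mod 2 ^ m" "(j + 1) mod 3"])
    show "(j + 1) mod 3 \<in> {0, 1, 2}" by auto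
  qed auto
  have i: "i - i mod 2 ^ m = 2 ^ m * j"
    by (simp add: j_def minus_mod_eq_mult_div)
  have "j mod 3 \<noteq> (j + 1) mod 3" by presburger
  then have at: "row m L \<sigma> i" by (simp add: row i)
  have after: "\<not> row m L \<sigma> x" if "i < x" "x < i + 2 * 2 ^ m" for x
  proof
    assume r: "row m L \<sigma> x"
    then obtain k where k: "x - i mod 2 ^ m = 2 ^ m * k" using row by blast
    have "2 ^ m * j < 2 ^ m * k" "2 ^ m * k < (2::int) ^ m * (j + 2)"
      unfolding distrib_left using that k i by linarith+
    then have "j < k" "k < j + 2" by simp_all
    then have "k = j + 1" by simp
    with r k show False by (simp add: row)
  qed
  show thesis
  proof (rule that[OF xor_bij[OF \<sigma>]])
    fix b :: "int \<Rightarrow> bool" and x :: int and n :: nat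
    show "row m L (\<lambda>x. b x \<noteq> \<sigma> x) x = row m L b x" if "i < x" "x < i + 2 * 2 ^ m" for x
      using after[OF that] by (simp only: row_xor) simp
    assume n: "n < 2 ^ m"
    then have *: "int n < 2 ^ m" by (metis of_nat_less_iff of_nat_numeral of_nat_power)
    have "\<not> row m L \<sigma> z" if "i + int n - int n < z" "z \<le> i + int n + int n" for z
      by (rule after; use that * in linarith)
    then have "(T ^^ n) (row m L \<sigma>) (i + int n)"
      by (rule T_left_end) (use at in simp_all)
    moreover have "row m L (\<lambda>x. b x \<noteq> \<sigma> x) = (\<lambda>x. row m L b x \<noteq> row m L \<sigma> x)"
      by (rule ext) (rule row_xor)
    ultimately show "(T ^^ n) (row m L (\<lambda>x. b x \<noteq> \<sigma> x)) (i + int n) = (\<not> (T ^^ n) (row m L b) (i + int n))"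
      by (simp only: T_xor) simp
  qed
qed

text \<open>Under the uniform measure on \<open>S\<close>, \<open>A\<close> is a fair bit
  independent of \<open>F\<close>, since a bijection of \<open>S\<close> flips \<open>A\<close> and
  preserves \<open>F\<close>.\<close>

lemma sum_toggle:
  fixes F :: "'a \<Rightarrow> bool \<Rightarrow> nat"
  assumes "bij_betw \<phi> S S" "\<And>b v. b \<in> S \<Longrightarrow> F (\<phi> b) v = F b v"
    "\<And>b. b \<in> S \<Longrightarrow> A (\<phi> b) = (\<not> A b)"
  shows "2 * (\<Sum>b\<in>S. F b (A b)) = (\<Sum>b\<in>S. F b False + F b True)"
proof -
  have "(\<Sum>b\<in>S. F b (A b)) = (\<Sum>b\<in>S. F (\<phi> b) (A (\<phi> b)))"
    using sum.reindex_bij_betw[OF assms(1), of "\<lambda>b. F b (A b)"] by simp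
  also have "\<dots> = (\<Sum>b\<in>S. F b (\<not> A b))"
    using assms by (intro sum.cong) auto
  finally have "2 * (\<Sum>b\<in>S. F b (A b)) = (\<Sum>b\<in>S. F b (A b) + F b (\<not> A b))"
    by (simp add: sum.distrib)
  also have "\<dots> = (\<Sum>b\<in>S. F b False + F b True)"
  proof (intro sum.cong refl)
    show "F b (A b) + F b (\<not> A b) = F b False + F b True" for b
      by (cases "A b") simp_all
  qed
  finally show ?thesis .
qed

section \<open>Decay of the expected weighted number of paths\<close>

definition cell_weight :: "bool \<Rightarrow> (int \<Rightarrow> bool) \<Rightarrow> nat \<Rightarrow> int \<Rightarrow> nat" where
  "cell_weight dg r n y =
    paths dg r n True y * weight dg True ((T ^^ n) r (y - 1)) ((T ^^ n) r (y + 1)) +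
    paths dg r n False y * weight dg False ((T ^^ n) r (y - 1)) ((T ^^ n) r (y + 1))"

text \<open>An expected weight over one spatial period, multiplied by the number of seeds so that
  the estimates stay within the natural numbers.\<close>

definition potential :: "bool \<Rightarrow> nat \<Rightarrow> nat \<Rightarrow> nat \<Rightarrow> nat" where
  "potential dg m L n = (\<Sum>b\<in>seeds L. \<Sum>y\<in>{0..<3 * 2 ^ m}. cell_weight dg (row m L b) n y)"

text \<open>The three masses collect the paths leaving \<open>x\<close> by a given kind of step,
  under those conditions that are decided by the cells next to \<open>x\<close>. Conditions on cells
  at distance 2 or 3 enter only in \<open>right_out\<close>, \<open>stay_out\<close> and
  \<open>left_out\<close>, where they act as fresh bits.\<close>

definition right_mass :: "bool \<Rightarrow> (int \<Rightarrow> bool) \<Rightarrow> nat \<Rightarrow> int \<Rightarrow> nat" where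
  "right_mass dg r n x = of_bool (right_ok dg ((T ^^ n) r (x - 1)) ((T ^^ n) r (x + 1))) *
    (paths dg r n True x + of_bool ((T ^^ n) r (x + 1)) * paths dg r n False x)"

definition stay_mass :: "bool \<Rightarrow> (int \<Rightarrow> bool) \<Rightarrow> nat \<Rightarrow> int \<Rightarrow> nat" where
  "stay_mass dg r n x = of_bool (\<not> dg \<and> (T ^^ n) r (x - 1) = (T ^^ n) r (x + 1)) *
    (paths dg r n True x + of_bool ((T ^^ n) r (x + 1)) * paths dg r n False x)"

definition left_mass :: "bool \<Rightarrow> (int \<Rightarrow> bool) \<Rightarrow> nat \<Rightarrow> int \<Rightarrow> nat" where
  "left_mass dg r n x = of_bool (left_ok dg ((T ^^ n) r (x - 1)) ((T ^^ n) r (x + 1))) *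
    (paths dg r n True x + paths dg r n False x)"

definition right_out :: "bool \<Rightarrow> (int \<Rightarrow> bool) \<Rightarrow> nat \<Rightarrow> int \<Rightarrow> nat" where
  "right_out dg r n x = of_bool ((T ^^ n) r (x + 2) = (T ^^ n) r (x + 1)) * right_mass dg r n x *
    weight dg True ((T ^^ n) r (x - 1) \<noteq> (T ^^ n) r (x + 1)) ((T ^^ n) r (x + 3))"

definition stay_out :: "bool \<Rightarrow> (int \<Rightarrow> bool) \<Rightarrow> nat \<Rightarrow> int \<Rightarrow> nat" where
  "stay_out dg r n x = stay_mass dg r n x *
    weight dg False ((T ^^ n) r (x - 2) \<noteq> (T ^^ n) r (x - 1)) ((T ^^ n) r (x + 2) \<noteq> (T ^^ n) r (x + 1))"

definition left_out :: "bool \<Rightarrow> (int \<Rightarrow> bool) \<Rightarrow> nat \<Rightarrow> int \<Rightarrow> nat" where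
  "left_out dg r n x = of_bool ((T ^^ n) r (x - 2) = (T ^^ n) r (x - 1)) * left_mass dg r n x *
    weight dg False ((T ^^ n) r (x - 3)) ((T ^^ n) r (x - 1) \<noteq> (T ^^ n) r (x + 1))"

text \<open>Paths are regrouped by the cell they depart from. That cell carries no 1, since
  otherwise the path counts vanish, and this simplifies the neighbours at the next time to
  expressions in cells of time \<open>n\<close>.\<close>

lemma cell_weight_Suc:
  "cell_weight dg r (Suc n) y = right_out dg r n (y - 1) + stay_out dg r n y + left_out dg r n (y + 1)"
proof -
  let ?c = "(T ^^ n) r"
  let ?d = "(T ^^ Suc n) r"
  have R: "of_bool (\<not> ?d y) * (of_bool (right_ok dg (?c (y - 2)) (?c y)) *
       (paths dg r n True (y - 1) + of_bool (?c y) * paths dg r n False (y - 1))) *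
       weight dg True (?d (y - 1)) (?d (y + 1)) = right_out dg r n (y - 1)"
  proof (cases "?c (y - 1)")
    case True
    then show ?thesis by (simp add: right_out_def right_mass_def paths_zero)
  next
    case False
    then show ?thesis
      by (cases "?c (y + 1) = ?c y"; cases "?c y") (simp_all add: right_out_def right_mass_def T_Suc add.commute)
  qed
  have V: "of_bool (\<not> ?d y) * (of_bool (\<not> dg) * (paths dg r n True y + of_bool (?c (y + 1)) * paths dg r n False y)) *
       weight dg False (?d (y - 1)) (?d (y + 1)) = stay_out dg r n y"
  proof (cases "?c y")
    case True
    then show ?thesis by (simp add: stay_out_def stay_mass_def paths_zero)
  next
    case False
    then show ?thesis
      by (cases "?c (y + 1)") (simp_all add: stay_out_def stay_mass_def T_Suc add.commute)
  qed
  have L: "of_bool (\<not> ?d y) * (of_bool (left_ok dg (?c y) (?c (y + 2))) *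
       (paths dg r n True (y + 1) + paths dg r n False (y + 1))) *
       weight dg False (?d (y - 1)) (?d (y + 1)) = left_out dg r n (y + 1)"
  proof (cases "?c (y + 1)")
    case True
    then show ?thesis by (simp add: left_out_def left_mass_def paths_zero)
  next
    case False
    then show ?thesis
      by (cases "?c (y - 1) = ?c y") (simp_all add: left_out_def left_mass_def T_Suc add.commute)
  qed
  show ?thesis
    unfolding R[symmetric] V[symmetric] L[symmetric] cell_weight_def paths.simps if_True if_False
    by (simp add: algebra_simps)
qed

text \<open>First the value at \<open>x + 3\<close> is averaged by \<open>\<phi>\<close>, which
  fixes everything used at \<open>x + 2\<close> and before, then the value at \<open>x + 2\<close>
  by \<open>\<psi>\<close>. The order matters: \<open>\<psi>\<close> may disturb
  \<open>x + 3\<close>, which by then no longer occurs. The bound on \<open>n\<close> keeps the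
  leftmost cell involved, \<open>x - n - 1\<close>, inside the window that toggling leaves
  unchanged.\<close>

lemma right_out_mean:
  assumes "2 * 2 ^ m \<le> int L + 1" "n + 3 \<le> 2 ^ m"
  shows "4 * (\<Sum>b\<in>seeds L. right_out dg (row m L b) n x) =
    (\<Sum>b\<in>seeds L. right_mass dg (row m L b) n x *
      (weight dg True ((T ^^ n) (row m L b) (x - 1) \<noteq> (T ^^ n) (row m L b) (x + 1)) False +
       weight dg True ((T ^^ n) (row m L b) (x - 1) \<noteq> (T ^^ n) (row m L b) (x + 1)) True))"
proof -
  let ?c = "\<lambda>b. (T ^^ n) (row m L b)"
  have n: "int n + 3 \<le> 2 ^ m"
    using assms(2) by (metis of_nat_add of_nat_le_iff of_nat_numeral of_nat_power)
  have n': "n < 2 ^ m" using assms(2) by simp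
  obtain \<phi> where \<phi>: "bij_betw \<phi> (seeds L) (seeds L)"
    and same: "\<And>b y. x + 3 + int n - 2 * 2 ^ m < y \<Longrightarrow> y < x + 3 + int n \<Longrightarrow> row m L (\<phi> b) y = row m L b y"
    and flip: "\<And>b k. k < 2 ^ m \<Longrightarrow> (T ^^ k) (row m L (\<phi> b)) (x + 3 + int n - int k) = (\<not> (T ^^ k) (row m L b) (x + 3 + int n - int k))"
    by (rule right_flip[OF assms(1)]) blast
  obtain \<psi> where \<psi>: "bij_betw \<psi> (seeds L) (seeds L)"
    and same': "\<And>b y. x + 2 + int n - 2 * 2 ^ m < y \<Longrightarrow> y < x + 2 + int n \<Longrightarrow> row m L (\<psi> b) y = row m L b y"
    and flip': "\<And>b k. k < 2 ^ m \<Longrightarrow> (T ^^ k) (row m L (\<psi> b)) (x + 2 + int n - int k) = (\<not> (T ^^ k) (row m L b) (x + 2 + int n - int k))"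
    by (rule right_flip[OF assms(1)]) blast
  have c: "?c (\<phi> b) y = ?c b y" if "x - 1 \<le> y" "y \<le> x + 2" for b y
    by (rule T_local, rule same) (use that n in auto)
  have p: "paths dg (row m L (\<phi> b)) n k x = paths dg (row m L b) n k x" for b k
    by (rule paths_local, rule same) (use n in auto)
  have c': "?c (\<psi> b) y = ?c b y" if "x - 1 \<le> y" "y \<le> x + 1" for b y
    by (rule T_local, rule same') (use that n in auto)
  have p': "paths dg (row m L (\<psi> b)) n k x = paths dg (row m L b) n k x" for b k
    by (rule paths_local, rule same') (use n in auto)
  let ?F = "\<lambda>b. (\<lambda>v. of_bool v * right_mass dg (row m L b) n x *
      (weight dg True (?c b (x - 1) \<noteq> ?c b (x + 1)) False + weight dg True (?c b (x - 1) \<noteq> ?c b (x + 1)) True))"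
  have "2 * (\<Sum>b\<in>seeds L. right_out dg (row m L b) n x) =
    (\<Sum>b\<in>seeds L. (\<lambda>v. of_bool (?c b (x + 2) = ?c b (x + 1)) * right_mass dg (row m L b) n x *
      weight dg True (?c b (x - 1) \<noteq> ?c b (x + 1)) v) False +
      (\<lambda>v. of_bool (?c b (x + 2) = ?c b (x + 1)) * right_mass dg (row m L b) n x *
      weight dg True (?c b (x - 1) \<noteq> ?c b (x + 1)) v) True)"
    unfolding right_out_def
    by (rule sum_toggle[OF \<phi>]) (use flip[OF n'] in \<open>simp_all add: c p right_mass_def\<close>)
  also have "\<dots> = (\<Sum>b\<in>seeds L. ?F b (?c b (x + 2) = ?c b (x + 1)))"
    by (simp add: algebra_simps)
  finally have twice: "2 * (\<Sum>b\<in>seeds L. right_out dg (row m L b) n x) =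
    (\<Sum>b\<in>seeds L. ?F b (?c b (x + 2) = ?c b (x + 1)))" .
  have "2 * (\<Sum>b\<in>seeds L. ?F b (?c b (x + 2) = ?c b (x + 1))) = (\<Sum>b\<in>seeds L. ?F b False + ?F b True)"
    by (rule sum_toggle[OF \<psi>]) (use flip'[OF n'] in \<open>auto simp: c' p' right_mass_def\<close>)
  then have "4 * (\<Sum>b\<in>seeds L. right_out dg (row m L b) n x) = (\<Sum>b\<in>seeds L. ?F b False + ?F b True)"
    unfolding twice[symmetric] by (simp only: mult.assoc[symmetric])
  then show ?thesis by (simp add: algebra_simps)
qed

lemma left_out_mean:
  assumes "2 * 2 ^ m \<le> int L + 1" "n + 3 \<le> 2 ^ m"
  shows "4 * (\<Sum>b\<in>seeds L. left_out dg (row m L b) n x) =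
    (\<Sum>b\<in>seeds L. left_mass dg (row m L b) n x *
      (weight dg False False ((T ^^ n) (row m L b) (x - 1) \<noteq> (T ^^ n) (row m L b) (x + 1)) +
       weight dg False True ((T ^^ n) (row m L b) (x - 1) \<noteq> (T ^^ n) (row m L b) (x + 1))))"
proof -
  let ?c = "\<lambda>b. (T ^^ n) (row m L b)"
  have n: "int n + 3 \<le> 2 ^ m"
    using assms(2) by (metis of_nat_add of_nat_le_iff of_nat_numeral of_nat_power)
  have n': "n < 2 ^ m" using assms(2) by simp
  obtain \<phi> where \<phi>: "bij_betw \<phi> (seeds L) (seeds L)"
    and same: "\<And>b y. x - 3 - int n < y \<Longrightarrow> y < x - 3 - int n + 2 * 2 ^ m \<Longrightarrow> row m L (\<phi> b) y = row m L b y"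
    and flip: "\<And>b k. k < 2 ^ m \<Longrightarrow> (T ^^ k) (row m L (\<phi> b)) (x - 3 - int n + int k) = (\<not> (T ^^ k) (row m L b) (x - 3 - int n + int k))"
    by (rule left_flip[OF assms(1)]) blast
  obtain \<psi> where \<psi>: "bij_betw \<psi> (seeds L) (seeds L)"
    and same': "\<And>b y. x - 2 - int n < y \<Longrightarrow> y < x - 2 - int n + 2 * 2 ^ m \<Longrightarrow> row m L (\<psi> b) y = row m L b y"
    and flip': "\<And>b k. k < 2 ^ m \<Longrightarrow> (T ^^ k) (row m L (\<psi> b)) (x - 2 - int n + int k) = (\<not> (T ^^ k) (row m L b) (x - 2 - int n + int k))"
    by (rule left_flip[OF assms(1)]) blast
  have c: "?c (\<phi> b) y = ?c b y" if "x - 2 \<le> y" "y \<le> x + 1" for b y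
    by (rule T_local, rule same) (use that n in auto)
  have p: "paths dg (row m L (\<phi> b)) n k x = paths dg (row m L b) n k x" for b k
    by (rule paths_local, rule same) (use n in auto)
  have c': "?c (\<psi> b) y = ?c b y" if "x - 1 \<le> y" "y \<le> x + 1" for b y
    by (rule T_local, rule same') (use that n in auto)
  have p': "paths dg (row m L (\<psi> b)) n k x = paths dg (row m L b) n k x" for b k
    by (rule paths_local, rule same') (use n in auto)
  let ?F = "\<lambda>b. (\<lambda>v. of_bool v * left_mass dg (row m L b) n x *
      (weight dg False False (?c b (x - 1) \<noteq> ?c b (x + 1)) + weight dg False True (?c b (x - 1) \<noteq> ?c b (x + 1))))"
  have "2 * (\<Sum>b\<in>seeds L. left_out dg (row m L b) n x) =
    (\<Sum>b\<in>seeds L. (\<lambda>v. of_bool (?c b (x - 2) = ?c b (x - 1)) * left_mass dg (row m L b) n x *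
      weight dg False v (?c b (x - 1) \<noteq> ?c b (x + 1))) False +
      (\<lambda>v. of_bool (?c b (x - 2) = ?c b (x - 1)) * left_mass dg (row m L b) n x *
      weight dg False v (?c b (x - 1) \<noteq> ?c b (x + 1))) True)"
    unfolding left_out_def
    by (rule sum_toggle[OF \<phi>]) (use flip[OF n'] in \<open>simp_all add: c p left_mass_def\<close>)
  also have "\<dots> = (\<Sum>b\<in>seeds L. ?F b (?c b (x - 2) = ?c b (x - 1)))"
    by (simp add: algebra_simps)
  finally have twice: "2 * (\<Sum>b\<in>seeds L. left_out dg (row m L b) n x) =
    (\<Sum>b\<in>seeds L. ?F b (?c b (x - 2) = ?c b (x - 1)))" .
  have "2 * (\<Sum>b\<in>seeds L. ?F b (?c b (x - 2) = ?c b (x - 1))) = (\<Sum>b\<in>seeds L. ?F b False + ?F b True)"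
    by (rule sum_toggle[OF \<psi>]) (use flip'[OF n'] in \<open>auto simp: c' p' left_mass_def\<close>)
  then have "4 * (\<Sum>b\<in>seeds L. left_out dg (row m L b) n x) = (\<Sum>b\<in>seeds L. ?F b False + ?F b True)"
    unfolding twice[symmetric] by (simp only: mult.assoc[symmetric])
  then show ?thesis by (simp add: algebra_simps)
qed

text \<open>Here the fresh bits lie on opposite sides: \<open>x + 2\<close> is toggled from the
  right while \<open>x - 2\<close> is held fixed, and then \<open>x - 2\<close> is toggled from the
  left.\<close>

lemma stay_out_mean:
  assumes "2 * 2 ^ m \<le> int L + 1" "n + 3 \<le> 2 ^ m"
  shows "4 * (\<Sum>b\<in>seeds L. stay_out dg (row m L b) n x) =
    (\<Sum>b\<in>seeds L. stay_mass dg (row m L b) n x *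
      (weight dg False False False + weight dg False False True +
       weight dg False True False + weight dg False True True))"
proof -
  let ?c = "\<lambda>b. (T ^^ n) (row m L b)"
  have n: "int n + 3 \<le> 2 ^ m"
    using assms(2) by (metis of_nat_add of_nat_le_iff of_nat_numeral of_nat_power)
  have n': "n < 2 ^ m" using assms(2) by simp
  obtain \<phi> where \<phi>: "bij_betw \<phi> (seeds L) (seeds L)"
    and same: "\<And>b y. x + 2 + int n - 2 * 2 ^ m < y \<Longrightarrow> y < x + 2 + int n \<Longrightarrow> row m L (\<phi> b) y = row m L b y"
    and flip: "\<And>b k. k < 2 ^ m \<Longrightarrow> (T ^^ k) (row m L (\<phi> b)) (x + 2 + int n - int k) = (\<not> (T ^^ k) (row m L b) (x + 2 + int n - int k))"
    by (rule right_flip[OF assms(1)]) blast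
  obtain \<psi> where \<psi>: "bij_betw \<psi> (seeds L) (seeds L)"
    and same': "\<And>b y. x - 2 - int n < y \<Longrightarrow> y < x - 2 - int n + 2 * 2 ^ m \<Longrightarrow> row m L (\<psi> b) y = row m L b y"
    and flip': "\<And>b k. k < 2 ^ m \<Longrightarrow> (T ^^ k) (row m L (\<psi> b)) (x - 2 - int n + int k) = (\<not> (T ^^ k) (row m L b) (x - 2 - int n + int k))"
    by (rule left_flip[OF assms(1)]) blast
  have c: "?c (\<phi> b) y = ?c b y" if "x - 2 \<le> y" "y \<le> x + 1" for b y
    by (rule T_local, rule same) (use that n in auto)
  have p: "paths dg (row m L (\<phi> b)) n k x = paths dg (row m L b) n k x" for b k
    by (rule paths_local, rule same) (use n in auto)
  have c': "?c (\<psi> b) y = ?c b y" if "x - 1 \<le> y" "y \<le> x + 1" for b y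
    by (rule T_local, rule same') (use that n in auto)
  have p': "paths dg (row m L (\<psi> b)) n k x = paths dg (row m L b) n k x" for b k
    by (rule paths_local, rule same') (use n in auto)
  let ?F = "\<lambda>b. (\<lambda>v. stay_mass dg (row m L b) n x *
      (weight dg False v False + weight dg False v True))"
  have "2 * (\<Sum>b\<in>seeds L. stay_out dg (row m L b) n x) =
    (\<Sum>b\<in>seeds L. (\<lambda>v. stay_mass dg (row m L b) n x *
      weight dg False (?c b (x - 2) \<noteq> ?c b (x - 1)) v) False +
      (\<lambda>v. stay_mass dg (row m L b) n x *
      weight dg False (?c b (x - 2) \<noteq> ?c b (x - 1)) v) True)"
    unfolding stay_out_def
    by (rule sum_toggle[OF \<phi>]) (use flip[OF n'] in \<open>simp_all add: c p stay_mass_def\<close>)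
  also have "\<dots> = (\<Sum>b\<in>seeds L. ?F b (?c b (x - 2) \<noteq> ?c b (x - 1)))"
    by (simp add: algebra_simps)
  finally have twice: "2 * (\<Sum>b\<in>seeds L. stay_out dg (row m L b) n x) =
    (\<Sum>b\<in>seeds L. ?F b (?c b (x - 2) \<noteq> ?c b (x - 1)))" .
  have "2 * (\<Sum>b\<in>seeds L. ?F b (?c b (x - 2) \<noteq> ?c b (x - 1))) = (\<Sum>b\<in>seeds L. ?F b False + ?F b True)"
    by (rule sum_toggle[OF \<psi>]) (use flip'[OF n'] in \<open>auto simp: c' p' stay_mass_def\<close>)
  then have "4 * (\<Sum>b\<in>seeds L. stay_out dg (row m L b) n x) = (\<Sum>b\<in>seeds L. ?F b False + ?F b True)"
    unfolding twice[symmetric] by (simp only: mult.assoc[symmetric])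
  then show ?thesis by (simp add: algebra_simps)
qed

lemma paths_row_periodic:
  "paths dg (row m L b) n k (y + 3 * 2 ^ m) = paths dg (row m L b) n k y"
  using paths_shift[of dg "row m L b" "3 * 2 ^ m" n k y] by (simp add: row_periodic)

lemma out_periodic:
  shows "right_out dg (row m L b) n (x + 3 * 2 ^ m) = right_out dg (row m L b) n x"
    and "stay_out dg (row m L b) n (x + 3 * 2 ^ m) = stay_out dg (row m L b) n x"
    and "left_out dg (row m L b) n (x + 3 * 2 ^ m) = left_out dg (row m L b) n x"
proof -
  have "(T ^^ n) (row m L b) (x + 3 * 2 ^ m + k) = (T ^^ n) (row m L b) (x + k)" for k
    using T_row_periodic[of n m L b "x + k"] by (simp add: algebra_simps)
  from this this[of "- _", simplified]
  show "right_out dg (row m L b) n (x + 3 * 2 ^ m) = right_out dg (row m L b) n x"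
    and "stay_out dg (row m L b) n (x + 3 * 2 ^ m) = stay_out dg (row m L b) n x"
    and "left_out dg (row m L b) n (x + 3 * 2 ^ m) = left_out dg (row m L b) n x"
    by (simp_all only: right_out_def stay_out_def left_out_def right_mass_def stay_mass_def
        left_mass_def paths_row_periodic diff_conv_add_uminus)
qed

lemma potential_Suc:
  assumes "2 * 2 ^ m \<le> int L + 1" "n + 3 \<le> 2 ^ m"
  shows "8 * potential dg m L (Suc n) \<le> 7 * potential dg m L n"
proof -
  let ?P = "{0..<3 * 2 ^ m :: int}"
  let ?c = "\<lambda>b. (T ^^ n) (row m L b)"
  \<comment> \<open>Over a full period the shifts by one between departure and arrival cells
    disappear.\<close>
  have "(\<Sum>y\<in>?P. cell_weight dg (row m L b) (Suc n) y) = (\<Sum>x\<in>?P. right_out dg (row m L b) n x) +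
      (\<Sum>x\<in>?P. stay_out dg (row m L b) n x) + (\<Sum>x\<in>?P. left_out dg (row m L b) n x)" for b
    using sum_periodic[of "right_out dg (row m L b) n" "3 * 2 ^ m" "- 1", OF out_periodic(1)]
      sum_periodic[of "left_out dg (row m L b) n" "3 * 2 ^ m" 1, OF out_periodic(3)]
    by (simp add: cell_weight_Suc sum.distrib)
  then have "potential dg m L (Suc n) = (\<Sum>x\<in>?P. \<Sum>b\<in>seeds L. right_out dg (row m L b) n x) +
      (\<Sum>x\<in>?P. \<Sum>b\<in>seeds L. stay_out dg (row m L b) n x) +
      (\<Sum>x\<in>?P. \<Sum>b\<in>seeds L. left_out dg (row m L b) n x)"
    by (simp add: potential_def sum.distrib sum.swap[of _ "seeds L"])
  then have four: "4 * potential dg m L (Suc n) = (\<Sum>x\<in>?P. 4 * (\<Sum>b\<in>seeds L. right_out dg (row m L b) n x)) +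
      (\<Sum>x\<in>?P. 4 * (\<Sum>b\<in>seeds L. stay_out dg (row m L b) n x)) +
      (\<Sum>x\<in>?P. 4 * (\<Sum>b\<in>seeds L. left_out dg (row m L b) n x))"
    by (simp only: sum_distrib_left[symmetric] distrib_left)
  have "8 * (4 * potential dg m L (Suc n)) = (\<Sum>x\<in>?P. \<Sum>b\<in>seeds L. 8 * (
      right_mass dg (row m L b) n x *
       (weight dg True (?c b (x - 1) \<noteq> ?c b (x + 1)) False + weight dg True (?c b (x - 1) \<noteq> ?c b (x + 1)) True) +
      stay_mass dg (row m L b) n x *
       (weight dg False False False + weight dg False False True +
        weight dg False True False + weight dg False True True) +
      left_mass dg (row m L b) n x *
       (weight dg False False (?c b (x - 1) \<noteq> ?c b (x + 1)) + weight dg False True (?c b (x - 1) \<noteq> ?c b (x + 1)))))"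
    unfolding four right_out_mean[OF assms] stay_out_mean[OF assms] left_out_mean[OF assms]
    by (simp only: sum.distrib[symmetric] sum_distrib_left[symmetric])
  also have "\<dots> \<le> (\<Sum>x\<in>?P. \<Sum>b\<in>seeds L. 28 * cell_weight dg (row m L b) n x)"
    unfolding right_mass_def stay_mass_def left_mass_def cell_weight_def
    by (intro sum_mono weight_step)
  also have "\<dots> = 28 * potential dg m L n"
    by (simp add: potential_def sum.swap[of _ "seeds L"] sum_distrib_left)
  finally show ?thesis by simp
qed

lemma potential_le:
  assumes "2 * 2 ^ m \<le> int L + 1" "n + 2 \<le> 2 ^ m"
  shows "8 ^ n * potential dg m L n \<le> 7 ^ n * potential dg m L 0"
  using assms(2)
proof (induction n)
  case (Suc n)
  then have "8 ^ n * (8 * potential dg m L (Suc n)) \<le> 8 ^ n * (7 * potential dg m L n)"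
    by (intro mult_left_mono potential_Suc assms(1)) auto
  also have "\<dots> \<le> 7 * (7 ^ n * potential dg m L 0)"
    using Suc by simp
  finally show ?case by simp
qed simp

lemma potential_0: "potential dg m L 0 \<le> card (seeds L) * (3 * 2 ^ m * 84)"
proof -
  have "potential dg m L 0 \<le> (\<Sum>b\<in>seeds L. \<Sum>y\<in>{0..<3 * 2 ^ m :: int}. 84)"
    unfolding potential_def cell_weight_def
    by (intro sum_mono) (simp add: weight_le)
  also have "\<dots> = card (seeds L) * (3 * 2 ^ m * 84)"
    by (simp add: nat_mult_distrib nat_power_eq)
  finally show ?thesis .
qed

text \<open>The number \<open>2 ^ m - 2\<close> is the last time covered by
  \<open>potential_le\<close>; \<open>m \<ge> 1\<close> keeps the subtraction of natural numbers
  exact.\<close>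

definition confined :: "bool \<Rightarrow> nat \<Rightarrow> nat \<Rightarrow> (int \<Rightarrow> bool) \<Rightarrow> bool" where
  "confined dg m L b \<longleftrightarrow> m \<ge> 1 \<and> (\<forall>y. \<not> reach dg (row m L b) (2 ^ m - 2) y)"

text \<open>Markov's inequality: all weights are at least 1, so each seed with a surviving path
  contributes at least 1 to the potential. The factor 252 is 3 times the maximal weight 84, the 3
  coming from the period \<open>3 * 2 ^ m\<close>.\<close>

lemma card_not_confined:
  assumes "2 * 2 ^ m \<le> int L + 1" "m \<ge> 1"
  shows "real (card {b \<in> seeds L. \<not> confined dg m L b})
    \<le> (7 / 8) ^ (2 ^ m - 2) * (252 * 2 ^ m) * real (card (seeds L))"
proof -
  let ?n = "2 ^ m - 2 :: nat"
  have m2: "(2::nat) \<le> 2 ^ m"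
    using assms(2) power_increasing[of 1 m "2::nat"] by simp
  have "1 \<le> (\<Sum>y\<in>{0..<3 * 2 ^ m}. cell_weight dg (row m L b) ?n y)" if "\<not> confined dg m L b" for b
  proof -
    let ?r = "row m L b"
    obtain y where "reach dg ?r ?n y" using \<open>\<not> confined dg m L b\<close> assms(2) by (auto simp: confined_def)
    then have pos: "paths dg ?r ?n True y + paths dg ?r ?n False y > 0"
      by (rule reach_paths)
    define z where "z = y mod (3 * 2 ^ m)"
    have eq: "paths dg ?r ?n k z = paths dg ?r ?n k y" for k
      unfolding z_def
      by (rule periodic_mod[where F = "paths dg ?r ?n k" and P = "3 * 2 ^ m"]) (rule paths_row_periodic)
    have "1 \<le> paths dg ?r ?n True z * 1 + paths dg ?r ?n False z * 1"
      unfolding eq using pos by linarith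
    also have "\<dots> \<le> cell_weight dg ?r ?n z"
      unfolding cell_weight_def by (intro add_mono mult_left_mono weight_pos) auto
    also have "\<dots> \<le> (\<Sum>y\<in>{0..<3 * 2 ^ m}. cell_weight dg ?r ?n y)"
      by (rule member_le_sum) (auto simp: z_def)
    finally show ?thesis .
  qed
  then have "(\<Sum>b\<in>{b \<in> seeds L. \<not> confined dg m L b}. 1) \<le>
      (\<Sum>b\<in>{b \<in> seeds L. \<not> confined dg m L b}. \<Sum>y\<in>{0..<3 * 2 ^ m}. cell_weight dg (row m L b) ?n y)"
    by (intro sum_mono) auto
  also have "\<dots> \<le> potential dg m L ?n"
    unfolding potential_def by (intro sum_mono2 finite_seeds) auto
  finally have "8 ^ ?n * card {b \<in> seeds L. \<not> confined dg m L b} \<le> 8 ^ ?n * potential dg m L ?n"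
    by simp
  also have "\<dots> \<le> 7 ^ ?n * potential dg m L 0"
    using m2 by (intro potential_le assms) simp
  also have "\<dots> \<le> 7 ^ ?n * (card (seeds L) * (3 * 2 ^ m * 84))"
    by (intro mult_left_mono potential_0) simp
  finally have "8 ^ ?n * real (card {b \<in> seeds L. \<not> confined dg m L b}) \<le>
      7 ^ ?n * (real (card (seeds L)) * (3 * 2 ^ m * 84))"
    unfolding of_nat_le_iff[where 'a = real, symmetric] by simp
  then show ?thesis
    by (simp add: power_divide field_simps)
qed

section \<open>Voids\<close>

lemma evolve_shift: "evolve f (\<lambda>x. s (x + v)) t x = evolve f s t (x + v)"
proof (induction t arbitrary: x)
  case (Suc t)
  have *: "x - 2 + v = x + v - 2" "x - 1 + v = x + v - 1" "x + 1 + v = x + v + 1" "x + 2 + v = x + v + 2"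
    by auto
  show ?case by (simp only: evolve.simps Suc *)
qed simp

lemma evolve_add: "evolve f s (t + j) = evolve f (evolve f s t) j"
  by (induction j) auto

lemma evolve_agree:
  assumes "\<And>x. lo \<le> x \<Longrightarrow> x \<le> hi \<Longrightarrow> s x = s' x" "lo + 2 * int n \<le> x" "x \<le> hi - 2 * int n"
  shows "evolve f s n x = evolve f s' n x"
  using assms(2,3)
proof (induction n arbitrary: x)
  case (Suc n)
  have "evolve f s n y = evolve f s' n y" if "y \<in> {x - 2..x + 2}" for y
    by (rule Suc.IH) (use that Suc.prems in auto)
  then show ?case by simp
qed (use assms(1) in auto)

lemma reach_shift: "reach dg (\<lambda>x. b (x + u)) n y = reach dg b n (y + u)"
proof (induction n arbitrary: y)
  case (Suc n)
  have *: "y - 1 + u = y + u - 1" "y + 1 + u = y + u + 1" "y - 2 + u = y + u - 2"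
    "y + 2 + u = y + u + 2" by auto
  show ?case by (simp only: reach.simps T_shift Suc *)
qed simp

section \<open>The canonical evolution inside a void\<close>

text \<open>Cells without a 1 start as 0; for a confined seed, starting some of them as 2 would give
  the same states from time \<open>2 ^ m - 2\<close> on.\<close>

definition reference :: "rule \<Rightarrow> nat \<Rightarrow> nat \<Rightarrow> (int \<Rightarrow> bool) \<Rightarrow> nat \<Rightarrow> int \<Rightarrow> state" where
  "reference f m L b = evolve f (\<lambda>x. if row m L b x then 1 else 0)"

lemma reference_eq_1_iff:
  assumes "web_CA f"
  shows "reference f m L b j x = 1 \<longleftrightarrow> (T ^^ j) (row m L b) x"
proof -
  have "(\<lambda>y. (if row m L b y then 1 else 0 :: state) = 1) = row m L b" by auto
  then show ?thesis by (simp add: reference_def evolve_eq_1_iff[OF assms])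
qed

lemma T_row_vanishes_later: "2 ^ m \<le> j \<Longrightarrow> \<not> (T ^^ j) (row m L b) x"
proof -
  assume "2 ^ m \<le> j"
  then have "(T ^^ j) (row m L b) x = (T ^^ (j - 2 ^ m)) ((T ^^ (2 ^ m)) (row m L b)) x"
    by (simp add: funpow_add[symmetric, THEN fun_cong, unfolded o_def])
  then show ?thesis
    using T_zero[of x "j - 2 ^ m" "(T ^^ (2 ^ m)) (row m L b)"] T_row_vanishes by blast
qed

lemma reference_range:
  assumes "web_CA f" "2 ^ m \<le> j"
  shows "reference f m L b j x \<in> {0, 2}"
  using state_cases[of "reference f m L b j x"] reference_eq_1_iff[OF assms(1)]
    T_row_vanishes_later[OF assms(2)] by auto

lemma reference_periodic: "reference f m L b j (x + 3 * 2 ^ m) = reference f m L b j x"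
  using evolve_shift[of f "\<lambda>x. if row m L b x then 1 else 0" "3 * 2 ^ m" j x]
  by (simp add: reference_def row_periodic)

text \<open>Pigeonhole: each row is determined by one period, a word of length
  \<open>3 * 2 ^ m\<close> over three letters, and there are \<open>27 ^ (2 ^ m)\<close> such words.
  After a repetition the evolution cycles.\<close>

lemma reference_recurrence:
  obtains i p where "p > 0" "i \<le> 27 ^ (2 ^ m)"
    "\<And>j. j \<ge> i \<Longrightarrow> reference f m L b (j + p) = reference f m L b j"
proof -
  let ?P = "{0..<3 * 2 ^ m :: int}"
  let ?g = "\<lambda>j. restrict (reference f m L b j) ?P"
  have card: "card (?P \<rightarrow>\<^sub>E (UNIV :: state set)) = 27 ^ (2 ^ m)"
    by (simp add: card_PiE nat_mult_distrib nat_power_eq power_mult)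
  have "\<not> inj_on ?g {0..27 ^ (2 ^ m)}"
  proof (rule pigeonhole)
    have "card (?g ` {0..27 ^ (2 ^ m)}) \<le> card (?P \<rightarrow>\<^sub>E (UNIV :: state set))"
      by (rule card_mono) (auto intro!: finite_PiE)
    then show "card (?g ` {0..27 ^ (2 ^ m)}) < card {0..27 ^ (2 ^ m) :: nat}"
      by (simp add: card)
  qed
  then obtain i k where "i \<noteq> k" "i \<le> 27 ^ (2 ^ m)" "k \<le> 27 ^ (2 ^ m)" "?g i = ?g k"
    by (auto simp: inj_on_def)
  then obtain i k where ik: "i < k" "i \<le> 27 ^ (2 ^ m)" "?g i = ?g k"
    by (metis nat_neq_iff)
  have "reference f m L b i x = reference f m L b k x" for x
  proof -
    have "x mod (3 * 2 ^ m) \<in> ?P" by simp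
    with ik(3) have "reference f m L b i (x mod (3 * 2 ^ m)) = reference f m L b k (x mod (3 * 2 ^ m))"
      by (metis restrict_apply')
    then show ?thesis
      by (simp add: periodic_mod[where F = "reference f m L b _", OF reference_periodic])
  qed
  then have eq: "reference f m L b i = reference f m L b k" by blast
  show thesis
  proof
    show "0 < k - i" "i \<le> 27 ^ (2 ^ m)" using ik by auto
    fix j assume "i \<le> j"
    then obtain l where l: "j = i + l" using le_Suc_ex by blast
    have "j + (k - i) = k + l" using l ik by simp
    then have "reference f m L b (j + (k - i)) = evolve f (reference f m L b k) l"
      by (simp add: reference_def evolve_add)
    also have "\<dots> = reference f m L b j"
      unfolding eq[symmetric] by (simp add: reference_def evolve_add l)
    finally show "reference f m L b (j + (k - i)) = reference f m L b j" .
  qed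
qed

lemma reference_ether:
  assumes "web_CA f"
  obtains \<eta> where "ether \<eta>"
    "\<And>j x. 27 ^ (2 ^ m) + 2 ^ m \<le> j \<Longrightarrow> reference f m L b j x = \<eta> (x, int j)"
proof -
  obtain i p where p: "p > 0" "i \<le> 27 ^ (2 ^ m)"
    and rec: "\<And>j. j \<ge> i \<Longrightarrow> reference f m L b (j + p) = reference f m L b j"
    by (rule reference_recurrence) blast
  define J :: nat where "J = 27 ^ (2 ^ m) + 2 ^ m"
  have rec': "reference f m L b (J + l + p * k) = reference f m L b (J + l)" for l k
  proof (induction k)
    case (Suc k)
    have "reference f m L b (J + l + p * k + p) = reference f m L b (J + l + p * k)"
      by (rule rec) (use p in \<open>simp add: J_def\<close>)
    with Suc show ?case by (simp add: ac_simps)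
  qed simp
  \<comment> \<open>The time \<open>J\<close> lies beyond both the pre-period and the disappearance
    of the 1s; the cycle from \<open>J\<close> on is continued periodically to all integer
    times.\<close>
  define \<eta> where "\<eta> = (\<lambda>(x, t). reference f m L b (J + nat ((t - int J) mod int p)) x)"
  show thesis
  proof
    have range: "\<eta> (x, t) \<in> {0, 2}" for x t
      unfolding \<eta>_def prod.case by (rule reference_range[OF assms]) (simp add: J_def)
    have space: "\<eta> (x + 3 * 2 ^ m, t) = \<eta> (x, t)" for x t
      by (simp add: \<eta>_def reference_periodic)
    have time: "\<eta> (x, t + int p) = \<eta> (x, t)" for x t
    proof -
      have "(t + int p - int J) mod int p = (t - int J) mod int p"
        by (metis add_diff_eq diff_add_eq mod_add_self2)
      then show ?thesis by (simp add: \<eta>_def)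
    qed
    show "ether \<eta>"
      unfolding ether_def
    proof (intro conjI)
      show "range \<eta> \<subseteq> {0, 2}" using range by (auto simp only: surj_pair)
      show "\<exists>p>0. \<forall>x t. \<eta> (x + p, t) = \<eta> (x, t)"
        by (rule exI[of _ "3 * 2 ^ m"]) (simp add: space)
      show "\<exists>q>0. \<forall>x t. \<eta> (x, t + q) = \<eta> (x, t)"
        by (rule exI[of _ "int p"]) (simp add: time p)
    qed
    fix j :: nat and x assume "27 ^ (2 ^ m) + 2 ^ m \<le> j"
    then obtain l where l: "j = J + l" using le_Suc_ex J_def by blast
    have "reference f m L b (J + l mod p + p * (l div p)) = reference f m L b (J + l mod p)"
      by (rule rec')
    then show "reference f m L b j x = \<eta> (x, int j)"
      by (simp add: \<eta>_def l add.assoc nat_mod_distrib)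
  qed
qed

text \<open>Three phases: for \<open>2 ^ m - 2\<close> steps the evolutions are compared by
  influence paths, none of which survives; two further steps use locality only; from time
  \<open>2 ^ m\<close> on there are no 1s and the agreement persists.\<close>

lemma void_evolution:
  assumes f: "web_CA f" "compliant dg f" and conf: "confined dg m L b"
    and row: "\<And>x. lo \<le> x \<Longrightarrow> x \<le> hi \<Longrightarrow> (s x = 1) = row m L b (x + u)"
    and j: "2 ^ m \<le> j" "lo + 2 ^ m + int j \<le> x" "x \<le> hi - 2 ^ m - int j"
  shows "evolve f s j x = reference f m L b j (x + u)"
proof -
  have m: "2 \<le> (2::nat) ^ m"
    using conf power_increasing[of 1 m "2::nat"] by (simp add: confined_def)
  let ?z = "\<lambda>x. if row m L b (x + u) then 1 else 0 :: state"
  have z: "evolve f ?z i y = reference f m L b i (y + u)" for i y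
    unfolding reference_def by (rule evolve_shift[where s = "\<lambda>x. if row m L b x then 1 else 0"])
  have early: "evolve f s (2 ^ m - 2) y = evolve f ?z (2 ^ m - 2) y"
    if "lo + 2 * int (2 ^ m - 2) \<le> y" "y \<le> hi - 2 * int (2 ^ m - 2)" for y
  proof (rule ccontr)
    assume "evolve f s (2 ^ m - 2) y \<noteq> evolve f ?z (2 ^ m - 2) y"
    then have "reach dg (\<lambda>x. row m L b (x + u)) (2 ^ m - 2) y"
      by (intro disagreement_reach[OF f row _ that]) auto
    then show False using conf by (simp add: reach_shift confined_def)
  qed
  have split: "(2::nat) ^ m = (2 ^ m - 2) + 2" using m by simp
  \<comment> \<open>The two extra steps cost 4 cells per side, so the total margin is
    \<open>2 * (2 ^ m - 2) + 4 = 2 * 2 ^ m\<close>.\<close>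
  have at_base: "evolve f s (2 ^ m) y = evolve f ?z (2 ^ m) y"
    if "lo + 2 * 2 ^ m \<le> y" "y \<le> hi - 2 * 2 ^ m" for y
  proof -
    have "int (2 ^ m - 2) = 2 ^ m - 2" using m by (simp add: of_nat_diff)
    then have "evolve f (evolve f s (2 ^ m - 2)) 2 y = evolve f (evolve f ?z (2 ^ m - 2)) 2 y"
      using that by (intro evolve_agree[OF early]) auto
    then show ?thesis by (metis split evolve_add)
  qed
  have one: "(evolve f s i y = 1) = (T ^^ i) (\<lambda>x. row m L b (x + u)) y"
    if "lo + int i \<le> y" "y \<le> hi - int i" for i y
    unfolding evolve_eq_1_iff[OF f(1)] by (rule T_local, rule row) (use that in auto)
  \<comment> \<open>Without 1s, empty-compliance hides the two outermost inputs. The margin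
    therefore shrinks by one cell per step rather than two, which matches the slope of the sides of
    a void.\<close>
  have later: "evolve f s (2 ^ m + i) y = evolve f ?z (2 ^ m + i) y"
    if "lo + 2 * 2 ^ m + int i \<le> y" "y \<le> hi - 2 * 2 ^ m - int i" for i y
    using that
  proof (induction i arbitrary: y)
    case 0
    then show ?case using at_base by simp
  next
    case (Suc i)
    let ?t = "2 ^ m + i"
    have same: "evolve f s ?t v = evolve f ?z ?t v" if "y - 1 \<le> v" "v \<le> y + 1" for v
      by (rule Suc.IH) (use Suc.prems that in auto)
    have not1: "evolve f s ?t v \<noteq> 1 \<and> evolve f ?z ?t v \<noteq> 1" if "y - 2 \<le> v" "v \<le> y + 2" for v
    proof -
      have "(2::int) \<le> 2 ^ m" using m by (metis of_nat_le_iff of_nat_numeral of_nat_power)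
      then have "(evolve f s ?t v = 1) = (T ^^ ?t) (row m L b) (v + u)"
        unfolding T_shift[symmetric] by (intro one) (use Suc.prems that in auto)
      moreover have "\<not> (T ^^ ?t) (row m L b) (v + u)"
        by (rule T_row_vanishes_later) simp
      ultimately show ?thesis
        unfolding z by (simp add: reference_eq_1_iff[OF f(1)])
    qed
    have "f (evolve f s ?t (y - 2)) (evolve f s ?t (y - 1)) (evolve f s ?t y) (evolve f s ?t (y + 1)) (evolve f s ?t (y + 2))
      = f (evolve f ?z ?t (y - 2)) (evolve f s ?t (y - 1)) (evolve f s ?t y) (evolve f s ?t (y + 1)) (evolve f ?z ?t (y + 2))"
      by (rule empty_compliantD[OF compliant_empty_compliant[OF f(2)]]) (use not1 in auto)
    then show ?case using same[of "y - 1"] same[of y] same[of "y + 1"] by simp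
  qed
  obtain i where i: "j = 2 ^ m + i" using j(1) le_Suc_ex by blast
  have "evolve f s (2 ^ m + i) x = evolve f ?z (2 ^ m + i) x"
    by (rule later) (use j in \<open>simp_all add: i\<close>)
  then show ?thesis by (simp only: i z)
qed

section \<open>Zero triangles of the single-seed pattern\<close>

abbreviation single :: "nat \<Rightarrow> int \<Rightarrow> bool" where
  "single t \<equiv> (T ^^ t) (\<lambda>y. y = 0)"

lemma single_cone: "single t x \<Longrightarrow> \<bar>x\<bar> \<le> int t"
  by (rule ccontr) (use T_zero[of x t "\<lambda>y. y = 0"] in auto)

lemma single_edges: "single t (int t)" "single t (- int t)"
  by (rule T_left_end; simp) (rule T_right_end; simp)

text \<open>Backwards in time: if the preceding row has no 1 over the closed gap, the 1s at its ends
  must come from just outside, so the gap widens by one cell on each side. Row 0 contains only one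
  1, so this stops at some \<open>q0 \<ge> 1\<close>.\<close>

lemma void_base:
  assumes "single q a" "single q c" "a < k" "k < c" "\<And>y. a < y \<Longrightarrow> y < c \<Longrightarrow> \<not> single q y"
  shows "\<exists>q0. 1 \<le> q0 \<and> q0 \<le> q \<and> single q0 (a - int (q - q0)) \<and> single q0 (c + int (q - q0)) \<and>
    (\<forall>y. a - int (q - q0) < y \<and> y < c + int (q - q0) \<longrightarrow> \<not> single q0 y) \<and>
    (\<exists>y. a - int (q - q0) \<le> y \<and> y \<le> c + int (q - q0) \<and> single (q0 - 1) y)"
  using assms
proof (induction q arbitrary: a c)
  case 0
  then show ?case by simp
next
  case (Suc q)
  show ?case
  proof (cases "\<exists>y. a \<le> y \<and> y \<le> c \<and> single q y")
    case True
    with Suc.prems show ?thesis by (intro exI[of _ "Suc q"]) simp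
  next
    case False
    then have zero: "\<not> single q y" if "a \<le> y" "y \<le> c" for y using that by blast
    have "\<exists>q0. 1 \<le> q0 \<and> q0 \<le> q \<and> single q0 (a - 1 - int (q - q0)) \<and> single q0 (c + 1 + int (q - q0)) \<and>
      (\<forall>y. a - 1 - int (q - q0) < y \<and> y < c + 1 + int (q - q0) \<longrightarrow> \<not> single q0 y) \<and>
      (\<exists>y. a - 1 - int (q - q0) \<le> y \<and> y \<le> c + 1 + int (q - q0) \<and> single (q0 - 1) y)"
    proof (rule Suc.IH)
      show "single q (a - 1)" using Suc.prems zero[of a] zero[of "a + 1"] by (simp add: T_Suc)
      show "single q (c + 1)" using Suc.prems zero[of c] zero[of "c - 1"] by (simp add: T_Suc)
      show "a - 1 < k" "k < c + 1" using Suc.prems by auto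
      show "\<not> single q y" if "a - 1 < y" "y < c + 1" for y using zero that by auto
    qed
    then obtain q0 where q0: "1 \<le> q0" "q0 \<le> q" "single q0 (a - 1 - int (q - q0))"
      "single q0 (c + 1 + int (q - q0))"
      "\<forall>y. a - 1 - int (q - q0) < y \<and> y < c + 1 + int (q - q0) \<longrightarrow> \<not> single q0 y"
      "\<exists>y. a - 1 - int (q - q0) \<le> y \<and> y \<le> c + 1 + int (q - q0) \<and> single (q0 - 1) y" by blast
    have *: "a - int (Suc q - q0) = a - 1 - int (q - q0)" "c + int (Suc q - q0) = c + 1 + int (q - q0)"
      using q0(2) by (auto simp: Suc_diff_le)
    show ?thesis
      by (rule exI[of _ q0]) (use q0 in \<open>simp only: *, simp\<close>)
  qed
qed

text \<open>The outermost 1s of row \<open>q\<close> at distance \<open>q\<close> from the origin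
  enclose \<open>k\<close> in a maximal gap, to which \<open>void_base\<close> applies;
  \<open>a\<close> and \<open>c\<close> now denote the ends of the base.\<close>

lemma void_exists:
  assumes "\<not> single q k" "\<bar>k\<bar> < int q"
  obtains q0 a c where "1 \<le> q0" "q0 \<le> q" "a + int (q - q0) < k" "k < c - int (q - q0)"
    "single q (a + int (q - q0))" "single q (c - int (q - q0))"
    "single q0 a" "single q0 c" "\<And>y. a < y \<Longrightarrow> y < c \<Longrightarrow> \<not> single q0 y"
    "\<exists>y. a \<le> y \<and> y \<le> c \<and> single (q0 - 1) y"
proof -
  define A where "A = {y \<in> {- int q..k}. single q y}"
  define C where "C = {y \<in> {k..int q}. single q y}"
  have "finite A" "finite C"
    unfolding A_def C_def by (rule finite_subset[of _ "{- int q..int q}"]; use assms(2) in auto)+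
  moreover have "- int q \<in> A" "int q \<in> C"
    using single_edges[of q] assms(2) by (auto simp: A_def C_def)
  ultimately have A: "finite A" "A \<noteq> {}" and C: "finite C" "C \<noteq> {}" by auto
  have a: "single q (Max A)" "Max A < k" using Max_in[OF A] assms(1) by (auto simp: A_def order.order_iff_strict)
  have c: "single q (Min C)" "k < Min C" using Min_in[OF C] assms(1) by (auto simp: C_def order.order_iff_strict)
  have zero: "\<not> single q y" if "Max A < y" "y < Min C" for y
  proof
    assume y: "single q y"
    show False
    proof (cases "y \<le> k")
      case True
      with y that a have "y \<in> A" using single_cone[OF y] by (auto simp: A_def)
      then show False using Max_ge[OF A(1)] that by fastforce
    next
      case False
      with y that c have "y \<in> C" using single_cone[OF y] by (auto simp: C_def)
      then show False using Min_le[OF C(1)] that by fastforce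
    qed
  qed
  obtain q0 where q0: "1 \<le> q0" "q0 \<le> q" "single q0 (Max A - int (q - q0))"
      "single q0 (Min C + int (q - q0))"
      "\<forall>y. Max A - int (q - q0) < y \<and> y < Min C + int (q - q0) \<longrightarrow> \<not> single q0 y"
      "\<exists>y. Max A - int (q - q0) \<le> y \<and> y \<le> Min C + int (q - q0) \<and> single (q0 - 1) y"
    using void_base[OF a(1) c(1) a(2) c(2) zero] by blast
  show thesis
    by (rule that[of q0 "Max A - int (q - q0)" "Min C + int (q - q0)"]) (use q0 a c in auto)
qed

lemma void_edges:
  assumes "single q a" "single q c" "\<And>y. a < y \<Longrightarrow> y < c \<Longrightarrow> \<not> single q y" "2 * int i < c - a"
  shows "single (q + i) (a + int i) \<and> single (q + i) (c - int i) \<and>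
    (\<forall>y. a + int i < y \<and> y < c - int i \<longrightarrow> \<not> single (q + i) y)"
  using assms(4)
proof (induction i)
  case 0
  then show ?case using assms by simp
next
  case (Suc i)
  then have IH: "single (q + i) (a + int i)" "single (q + i) (c - int i)"
    "\<And>y. a + int i < y \<Longrightarrow> y < c - int i \<Longrightarrow> \<not> single (q + i) y" by auto
  have "single (Suc (q + i)) (a + int i + 1)"
    unfolding T_Suc using IH(1) IH(3)[of "a + int i + 1"] IH(3)[of "a + int i + 2"] Suc.prems by (simp add: ac_simps)
  moreover have "single (Suc (q + i)) (c - int i - 1)"
    unfolding T_Suc using IH(2) IH(3)[of "c - int i - 1"] IH(3)[of "c - int i - 2"] Suc.prems by simp
  moreover have "\<not> single (Suc (q + i)) y" if "a + int i + 1 < y" "y < c - int i - 1" for y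
    unfolding T_Suc using IH(3)[of "y - 1"] IH(3)[of y] IH(3)[of "y + 1"] that by simp
  ultimately show ?case by (simp add: algebra_simps)
qed

lemma recurrence_unique:
  fixes e e' :: "int \<Rightarrow> bool"
  assumes "\<And>y. a < y \<Longrightarrow> y < c \<Longrightarrow> e (y + 1) = (e y \<noteq> e (y - 1))"
    "\<And>y. a < y \<Longrightarrow> y < c \<Longrightarrow> e' (y + 1) = (e' y \<noteq> e' (y - 1))"
    "e a = e' a" "e (a + 1) = e' (a + 1)" "a \<le> y" "y \<le> c"
  shows "e y = e' y"
proof -
  have "a + int n + 1 \<le> c \<Longrightarrow> e (a + int n) = e' (a + int n) \<and> e (a + int n + 1) = e' (a + int n + 1)" for n
  proof (induction n)
    case 0
    then show ?case using assms(3,4) by simp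
  next
    case (Suc n)
    then have "e (a + int n) = e' (a + int n)" "e (a + int n + 1) = e' (a + int n + 1)" by auto
    with assms(1)[of "a + int n + 1"] assms(2)[of "a + int n + 1"] Suc.prems show ?case
      by (simp add: algebra_simps)
  qed
  from this[of "nat (y - a - 1)"] assms(3-6) show ?thesis
    by (cases "y = a") auto
qed

text \<open>Zeros in the next row impose the Fibonacci recurrence modulo 2, whose nonzero solutions
  are the three shifts of 110110...; the 1 at \<open>y0\<close> excludes the zero solution.\<close>

lemma void_pattern:
  fixes e :: "int \<Rightarrow> bool"
  assumes "\<And>y. a < y \<Longrightarrow> y < c \<Longrightarrow> e (y + 1) = (e y \<noteq> e (y - 1))" "a \<le> y0" "y0 \<le> c" "e y0"
  obtains \<phi> where "\<And>y. a \<le> y \<Longrightarrow> y \<le> c \<Longrightarrow> e y = ((y - \<phi>) mod 3 \<noteq> 2)"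
proof -
  have "e a \<or> e (a + 1)"
    using recurrence_unique[of a c e "\<lambda>_. False" y0] assms by auto
  \<comment> \<open>The initial pairs 11, 10 and 01 belong to the phases \<open>a\<close>,
    \<open>a - 1\<close> and \<open>a - 2\<close>, respectively.\<close>
  moreover have "\<exists>\<phi>. (e a = ((a - \<phi>) mod 3 \<noteq> 2)) \<and> (e (a + 1) = ((a + 1 - \<phi>) mod 3 \<noteq> 2))"
    if "e a \<or> e (a + 1)"
  proof (cases "e a")
    case True
    show ?thesis
      by (rule exI[of _ "if e (a + 1) then a else a - 1"]) (use True in simp)
  next
    case False
    with that show ?thesis by (intro exI[of _ "a - 2"]) simp
  qed
  ultimately obtain \<phi> where \<phi>: "e a = ((a - \<phi>) mod 3 \<noteq> 2)" "e (a + 1) = ((a + 1 - \<phi>) mod 3 \<noteq> 2)"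
    by blast
  have rec: "((y + 1 - \<phi>) mod 3 \<noteq> 2) = (((y - \<phi>) mod 3 \<noteq> 2) \<noteq> ((y - 1 - \<phi>) mod 3 \<noteq> 2))" for y
  proof -
    define z where "z = y - \<phi>"
    have "z mod 3 = 0 \<or> z mod 3 = 1 \<or> z mod 3 = 2" by presburger
    moreover have "z mod 3 = 0 \<Longrightarrow> (z + 1) mod 3 = 1" "z mod 3 = 0 \<Longrightarrow> (z - 1) mod 3 = 2"
      "z mod 3 = 1 \<Longrightarrow> (z + 1) mod 3 = 2" "z mod 3 = 1 \<Longrightarrow> (z - 1) mod 3 = 0"
      "z mod 3 = 2 \<Longrightarrow> (z + 1) mod 3 = 0" "z mod 3 = 2 \<Longrightarrow> (z - 1) mod 3 = 1"
      by presburger+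
    ultimately have "((z + 1) mod 3 \<noteq> 2) = ((z mod 3 \<noteq> 2) \<noteq> ((z - 1) mod 3 \<noteq> 2))"
      by (elim disjE) simp_all
    then show ?thesis by (simp add: z_def algebra_simps)
  qed
  show thesis
    by (rule that[of \<phi>], rule recurrence_unique[OF assms(1) rec]) (use \<phi> in auto)
qed

text \<open>Dilating the pattern gives a translate of \<open>comb\<close> between
  \<open>a * 2 ^ m\<close> and \<open>c * 2 ^ m\<close>. Copies shifted right by up to
  \<open>L\<close> are superposed, so \<open>L\<close> cells are lost at the left end only.\<close>

lemma void_row:
  assumes "b \<in> seeds L" "\<And>y. a \<le> y \<Longrightarrow> y \<le> c \<Longrightarrow> single q y = ((y - \<phi>) mod 3 \<noteq> 2)"
    and x: "a * 2 ^ m + int L \<le> x" "x \<le> c * 2 ^ m"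
  shows "(T ^^ (q * 2 ^ m)) b x = row m L b (x + - (\<phi> * 2 ^ m))"
proof -
  have eq: "single (q * 2 ^ m) z = comb m (z + - (\<phi> * 2 ^ m))" if "a * 2 ^ m \<le> z" "z \<le> c * 2 ^ m" for z
  proof (cases "2 ^ m dvd z")
    case True
    then obtain k where k: "z = 2 ^ m * k" by blast
    then have "a \<le> k" "k \<le> c" using that by (simp_all add: mult.commute[of _ "2 ^ m"])
    moreover have "z + - (\<phi> * 2 ^ m) = 2 ^ m * (k - \<phi>)" using k by (simp add: algebra_simps)
    ultimately show ?thesis using assms(2) k by (simp add: T_dilate comb_def)
  next
    case False
    then have "\<not> 2 ^ m dvd z + - (\<phi> * 2 ^ m)"
      by (simp add: dvd_diff_left_iff)
    with False show ?thesis by (simp only: T_dilate comb_def) simp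
  qed
  have "(T ^^ (q * 2 ^ m)) b x = superpose L (single (q * 2 ^ m)) b x"
    by (rule T_eq_superpose) (use assms(1) in \<open>auto simp: seeds_def\<close>)
  also have "\<dots> = superpose L (\<lambda>z. comb m (z + - (\<phi> * 2 ^ m))) b x"
    unfolding superpose_def by (rule arg_cong[where f = odd], rule sum.cong) (use x in \<open>auto simp: eq\<close>)
  also have "\<dots> = row m L b (x + - (\<phi> * 2 ^ m))"
    by (simp only: superpose_shift row_def)
  finally show ?thesis .
qed

section \<open>Components off the thickened fractal\<close>

lemma component_subset: "K \<in> nn_components S \<Longrightarrow> K \<subseteq> S"
  by (auto simp: nn_components_def quotient_def elim: rtranclE)

lemma component_nonempty: "K \<in> nn_components S \<Longrightarrow> K \<noteq> {}"
  by (auto simp: nn_components_def quotient_def)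

lemma component_closed:
  assumes "K \<in> nn_components S" "z \<in> K" "z' \<in> S" "l1_dist z z' = 1"
  shows "z' \<in> K"
proof -
  have "z \<in> S" using component_subset assms(1,2) by blast
  with assms(3,4) have "(z, z') \<in> nearest_neighbour \<inter> S \<times> S"
    by (simp add: nearest_neighbour_def)
  with assms(1,2) show ?thesis
    by (auto simp: nn_components_def quotient_def intro: rtrancl_into_rtrancl)
qed

lemma component_induct [consumes 3, case_names base step]:
  assumes "K \<in> nn_components S" "z0 \<in> K" "z \<in> K" "P z0"
    "\<And>z z'. P z \<Longrightarrow> z \<in> S \<Longrightarrow> z' \<in> S \<Longrightarrow> l1_dist z z' = 1 \<Longrightarrow> P z'"
  shows "P z"
proof -
  let ?R = "nearest_neighbour \<inter> S \<times> S"
  have "sym ?R"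
    by (auto simp: sym_def nearest_neighbour_def l1_dist_def abs_minus_commute)
  then have "sym (?R\<^sup>*)" by (rule sym_rtrancl)
  moreover obtain v where "(v, z0) \<in> ?R\<^sup>*" "(v, z) \<in> ?R\<^sup>*"
    using assms(1-3) by (auto simp: nn_components_def quotient_def)
  ultimately have "(z0, z) \<in> ?R\<^sup>*"
    by (meson rtrancl_trans symD)
  then show ?thesis
  proof (induction rule: rtrancl_induct)
    case base
    then show ?case using assms(4) .
  next
    case (step y z)
    then show ?case using assms(5)[of y z] by (auto simp: nearest_neighbour_def)
  qed
qed

lemma unbounded_component:
  assumes "K \<in> nn_components S" "(x, t) \<in> K" "\<bar>dx\<bar> + \<bar>dt\<bar> = 1"
    and run: "\<And>n. (x + int n * dx, t + int n * dt) \<in> S"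
  shows "\<not> bounded_lattice_set K"
proof
  have K: "(x + int n * dx, t + int n * dt) \<in> K" for n
  proof (induction n)
    case (Suc n)
    show ?case
      by (rule component_closed[OF assms(1) Suc run])
        (use assms(3) in \<open>simp add: l1_dist_def algebra_simps abs_minus_commute\<close>)
  qed (use assms(2) in simp)
  assume "bounded_lattice_set K"
  then obtain B where "l1_dist (x + int n * dx, t + int n * dt) (0, 0) \<le> B" for n
    using K unfolding bounded_lattice_set_def by blast
  from this[of "nat (B + \<bar>x\<bar> + \<bar>t\<bar> + 1)"] this[of 0]
  have B: "\<bar>x + (B + \<bar>x\<bar> + \<bar>t\<bar> + 1) * dx\<bar> + \<bar>t + (B + \<bar>x\<bar> + \<bar>t\<bar> + 1) * dt\<bar> \<le> B" "B \<ge> 0"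
    by (auto simp: l1_dist_def)
  have "dx = 1 \<and> dt = 0 \<or> dx = - 1 \<and> dt = 0 \<or> dx = 0 \<and> dt = 1 \<or> dx = 0 \<and> dt = - 1"
    using assms(3) by auto
  with B show False by auto
qed

lemma Lambda_cases:
  assumes "w \<in> \<Lambda>"
  obtains y s where "w = (y, int s)" "single s y" "\<bar>y\<bar> \<le> int s"
proof -
  obtain y s where "w = (y, int s)" using assms by (auto simp: \<Lambda>_def)
  with assms that show thesis using Lambda_iff single_cone by blast
qed

lemma off_Lambda_iff: "z \<in> - \<Lambda>_nbhd (real N) \<longleftrightarrow> (\<forall>w\<in>\<Lambda>. int N < l1_dist z w)"
  unfolding \<Lambda>_nbhd_def by (simp add: not_le) (metis of_int_less_iff of_int_of_nat_eq)

text \<open>From a point outside the cone a ray escapes to infinity: downwards from negative times,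
  otherwise horizontally away from the cone. In the horizontal case the cone's edge vertically above
  is already further than \<open>N\<close>, and the distance to the cone only grows along the
  ray.\<close>

lemma bounded_component_in_cone:
  assumes K: "K \<in> nn_components (- \<Lambda>_nbhd (real N))" "bounded_lattice_set K" "(x, t) \<in> K"
  shows "\<bar>x\<bar> \<le> t"
proof (rule ccontr)
  assume "\<not> \<bar>x\<bar> \<le> t"
  let ?S = "- \<Lambda>_nbhd (real N)"
  have far: "int N < l1_dist (x, t) w" if "w \<in> \<Lambda>" for w
    using component_subset[OF K(1)] K(3) that off_Lambda_iff by blast
  consider "t < 0" | "0 \<le> t" "t < x" | "0 \<le> t" "x < - t"
    using \<open>\<not> \<bar>x\<bar> \<le> t\<close> by linarith
  then show False
  proof cases
    case 1
    have "(x + int n * 0, t + int n * (- 1)) \<in> ?S" for n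
      unfolding off_Lambda_iff
    proof
      fix w assume w: "w \<in> \<Lambda>"
      then obtain y s where "w = (y, int s)" by (rule Lambda_cases)
      with far[OF w] 1 show "int N < l1_dist (x + int n * 0, t + int n * (- 1)) w"
        by (auto simp: l1_dist_def)
    qed
    with unbounded_component[OF K(1,3), of 0 "- 1"] K(2) show False by simp
  next
    case 2
    have "(x, int (nat x)) \<in> \<Lambda>" unfolding Lambda_iff using single_edges(1)[of "nat x"] 2 by simp
    from far[OF this] have x: "int N < x - t" using 2 by (simp add: l1_dist_def)
    have "(x + int n * 1, t + int n * 0) \<in> ?S" for n
      unfolding off_Lambda_iff
    proof
      fix w assume w: "w \<in> \<Lambda>"
      then obtain y s where "w = (y, int s)" "\<bar>y\<bar> \<le> int s" by (rule Lambda_cases)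
      with x show "int N < l1_dist (x + int n * 1, t + int n * 0) w"
        by (auto simp: l1_dist_def)
    qed
    with unbounded_component[OF K(1,3), of 1 0] K(2) show False by simp
  next
    case 3
    have "(x, int (nat (- x))) \<in> \<Lambda>" unfolding Lambda_iff using single_edges(2)[of "nat (- x)"] 3 by simp
    from far[OF this] have x: "int N < - x - t" using 3 by (simp add: l1_dist_def)
    have "(x + int n * (- 1), t + int n * 0) \<in> ?S" for n
      unfolding off_Lambda_iff
    proof
      fix w assume w: "w \<in> \<Lambda>"
      then obtain y s where "w = (y, int s)" "\<bar>y\<bar> \<le> int s" by (rule Lambda_cases)
      with x show "int N < l1_dist (x + int n * (- 1), t + int n * 0) w"
        by (auto simp: l1_dist_def)
    qed
    with unbounded_component[OF K(1,3), of "- 1" 0] K(2) show False by simp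
  qed
qed

section \<open>Components inside dilated zero triangles\<close>

text \<open>By \<open>T_dilate\<close>, the copy of \<Lambda> dilated by \<open>2 ^ m\<close> is
  contained in \<Lambda>.\<close>

lemma far_from_coarse:
  assumes "(x, t) \<in> - \<Lambda>_nbhd (real N)" "single q k"
  shows "int N < \<bar>x - k * 2 ^ m\<bar> + \<bar>t - int q * 2 ^ m\<bar>"
proof -
  have "(k * 2 ^ m, int (q * 2 ^ m)) \<in> \<Lambda>"
    unfolding Lambda_iff T_dilate using assms(2) by simp
  with assms(1) show ?thesis unfolding off_Lambda_iff by (force simp: l1_dist_def)
qed

text \<open>The first term outlasts the pre-period of the reference evolution; the second absorbs
  rounding to the coarse lattice and the margins of \<open>void_evolution\<close>.\<close>

definition thickness :: "nat \<Rightarrow> nat" where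
  "thickness m = 27 ^ (2 ^ m) + 8 * 2 ^ m"

text \<open>
  The zero triangle above the void base \<open>q0\<close> between \<open>a\<close> and \<open>c\<close>, dilated by \<open>2 ^ m\<close>.
\<close>
definition void :: "nat \<Rightarrow> nat \<Rightarrow> int \<Rightarrow> int \<Rightarrow> (int \<times> int) set" where
  "void m q0 a c = {(x, t). int q0 * 2 ^ m \<le> t \<and> a * 2 ^ m + (t - int q0 * 2 ^ m) < x \<and>
    x < c * 2 ^ m - (t - int q0 * 2 ^ m)}"

lemma coarse_div:
  obtains k \<kappa> where "(x::int) = k * 2 ^ m + \<kappa>" "0 \<le> \<kappa>" "\<kappa> < 2 ^ m"
  by (rule that[of "x div 2 ^ m" "x mod 2 ^ m"]) (auto simp: mult.commute)

text \<open>The point is rounded down to coarse coordinates \<open>(k, q)\<close>. A coarse 1 there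
  would be too close, so \<open>k\<close> lies in a gap of row \<open>q\<close>, and the zero
  triangle containing that gap, once dilated, contains the point.\<close>

lemma component_meets_void:
  assumes z: "(x, t) \<in> - \<Lambda>_nbhd (real N)" "\<bar>x\<bar> \<le> t" and N: "8 * 2 ^ m \<le> int N"
  obtains q0 a c where "1 \<le> q0" "a + 1 < c" "single q0 a" "single q0 c"
    "\<And>y. a < y \<Longrightarrow> y < c \<Longrightarrow> \<not> single q0 y" "\<exists>y. a \<le> y \<and> y \<le> c \<and> single (q0 - 1) y"
    "(x, t) \<in> void m q0 a c"
proof -
  define M :: int where "M = 2 ^ m"
  have M: "M > 0" by (simp add: M_def)
  have N': "8 * M \<le> int N" using N by (simp add: M_def)
  obtain k \<kappa> where k: "x = k * M + \<kappa>" "0 \<le> \<kappa>" "\<kappa> < M"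
    unfolding M_def by (rule coarse_div)
  obtain p \<rho> where p: "t = p * M + \<rho>" "0 \<le> \<rho>" "\<rho> < M"
    unfolding M_def by (rule coarse_div)
  have "0 \<le> p"
  proof (rule ccontr)
    assume "\<not> 0 \<le> p"
    then have "p * M \<le> (- 1) * M" using M by (intro mult_right_mono) auto
    with p z(2) show False by linarith
  qed
  then obtain q where q: "p = int q" using nonneg_int_cases by blast
  have far: "int N < \<bar>x - k' * M\<bar> + \<rho>" if "single q k'" for k'
    using far_from_coarse[OF z(1) that, of m] p q by (simp add: M_def)
  have not1: "\<not> single q k" using far[of k] k p N' by auto
  have "k < int q + 1"
  proof -
    have "k * M < (int q + 1) * M"
      unfolding distrib_right using k p q z(2) by simp
    then show ?thesis using M by simp
  qed
  moreover have "- int q - 2 < k"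
  proof -
    have "(- int q - 2) * M < k * M"
      unfolding left_diff_distrib using k p q z(2) by simp
    then show ?thesis using M mult_less_cancel_right_pos by blast
  qed
  moreover have "k \<noteq> int q" "k \<noteq> - int q" using single_edges[of q] not1 by auto
  \<comment> \<open>Rounding down can overshoot the cone by one coarse cell on the left, but then
    the left edge is too close.\<close>
  moreover have "k \<noteq> - int q - 1"
  proof
    assume "k = - int q - 1"
    then have "k * M = (- int q - 1) * M" by simp
    then have "x - (- int q) * M = \<kappa> - M" using k by (simp add: left_diff_distrib)
    with far[OF single_edges(2)] k p N' show False by auto
  qed
  ultimately have "\<bar>k\<bar> < int q" by linarith
  then obtain q0 a c where v: "1 \<le> q0" "q0 \<le> q" "a + int (q - q0) < k" "k < c - int (q - q0)"
    "single q (a + int (q - q0))" "single q (c - int (q - q0))"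
    "single q0 a" "single q0 c" "\<And>y. a < y \<Longrightarrow> y < c \<Longrightarrow> \<not> single q0 y"
    "\<exists>y. a \<le> y \<and> y \<le> c \<and> single (q0 - 1) y"
    by (rule void_exists[OF not1]) blast
  define i where "i = int (q - q0)"
  have q_i: "int q = int q0 + i" using v(2) by (simp add: i_def)
  have t: "t - int q0 * M = i * M + \<rho>" using p q q_i by (simp add: distrib_right)
  have "0 \<le> i * M" using M by (simp add: i_def)
  have "(a + i + 1) * M \<le> k * M" using v(3) M by (intro mult_right_mono) (auto simp: i_def)
  then have left: "a * M + i * M + M \<le> k * M" by (simp add: distrib_right)
  have "(k + 1) * M \<le> (c - i) * M" using v(4) M by (intro mult_right_mono) (auto simp: i_def)
  then have right: "k * M + M \<le> c * M - i * M" by (simp add: distrib_right left_diff_distrib)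
  have "int N < \<bar>x - (c * M - i * M)\<bar> + \<rho>"
    using far[OF v(6)] by (simp add: i_def left_diff_distrib)
  then have "x < c * M - (i * M + \<rho>)" using right k p N' by linarith
  moreover have "a * M + (i * M + \<rho>) < x" using left k p by linarith
  ultimately have "(x, t) \<in> void m q0 a c"
    using t p \<open>0 \<le> i * M\<close> by (simp add: void_def M_def)
  with v show thesis by (intro that[of q0 a c]) auto
qed

text \<open>All three sides of the triangle are near \<Lambda>: the pattern just before the base has
  no two consecutive zeros, and by \<open>void_edges\<close> every coarse row has a 1 on each
  slanted side. Rounding costs at most \<open>2 * 2 ^ m\<close>.\<close>

lemma void_margin:
  assumes v: "1 \<le> q0" "a + 1 < c" "single q0 a" "single q0 c"
    "\<And>y. a < y \<Longrightarrow> y < c \<Longrightarrow> \<not> single q0 y"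
    and pattern: "\<And>y. a \<le> y \<Longrightarrow> y \<le> c \<Longrightarrow> single (q0 - 1) y = ((y - \<phi>) mod 3 \<noteq> 2)"
    and z: "(x, t) \<in> - \<Lambda>_nbhd (real N)" "(x, t) \<in> void m q0 a c"
  shows "int N < t - int q0 * 2 ^ m + 2 * 2 ^ m"
    and "int N < x - (a * 2 ^ m + (t - int q0 * 2 ^ m)) + 2 * 2 ^ m"
    and "int N < c * 2 ^ m - (t - int q0 * 2 ^ m) - x + 2 * 2 ^ m"
proof -
  define M :: int where "M = 2 ^ m"
  have M: "M > 0" by (simp add: M_def)
  have in_void: "int q0 * M \<le> t" "a * M + (t - int q0 * M) < x" "x < c * M - (t - int q0 * M)"
    using z(2) by (auto simp: void_def M_def)
  have far: "int N < \<bar>x - k * M\<bar> + \<bar>t - int q * M\<bar>" if "single q k" for q k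
    using far_from_coarse[OF z(1) that, of m] by (simp add: M_def)
  obtain k \<kappa> where k: "x = k * M + \<kappa>" "0 \<le> \<kappa>" "\<kappa> < M"
    unfolding M_def by (rule coarse_div)
  obtain p \<rho> where p: "t = p * M + \<rho>" "0 \<le> \<rho>" "\<rho> < M"
    unfolding M_def by (rule coarse_div)
  have "int N < t - int q0 * M + 2 * M"
  proof -
    have "a * M < (k + 1) * M" "k * M < c * M"
      unfolding distrib_right using k in_void by linarith+
    then have "a < k + 1" "k < c" using M by (meson mult_less_cancel_right_pos)+
    moreover have "(k - \<phi>) mod 3 \<noteq> 2 \<or> (k + 1 - \<phi>) mod 3 \<noteq> 2" by presburger
    ultimately have "single (q0 - 1) k \<or> single (q0 - 1) (k + 1)"
      using pattern[of k] pattern[of "k + 1"] by auto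
    then obtain k' where "single (q0 - 1) k'" "k' = k \<or> k' = k + 1" by blast
    then have "int N < \<bar>x - k' * M\<bar> + \<bar>t - int (q0 - 1) * M\<bar>" "\<bar>x - k' * M\<bar> \<le> M"
      using far k by (auto simp: distrib_right)
    moreover have "int (q0 - 1) * M = int q0 * M - M"
      using v(1) by (simp add: of_nat_diff left_diff_distrib)
    ultimately show ?thesis using in_void(1) M by linarith
  qed
  have "int q0 * M < (p + 1) * M"
    unfolding distrib_right using p in_void(1) by simp
  then have "int q0 \<le> p" using M by (simp add: mult_less_cancel_right_pos)
  then obtain i where i: "p = int (q0 + i)" using zle_iff_zadd by auto
  have t: "t - int q0 * M = int i * M + \<rho>" using p i by (simp add: distrib_right)
  have "(2 * int i) * M < (c - a) * M"
    using in_void t p(2) by (simp add: left_diff_distrib)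
  then have "2 * int i < c - a" using M mult_less_cancel_right_pos by blast
  from void_edges[OF v(3-5) this]
  have "int N < \<bar>x - (a + int i) * M\<bar> + \<bar>t - p * M\<bar>" "int N < \<bar>x - (c - int i) * M\<bar> + \<bar>t - p * M\<bar>"
    using far i by blast+
  then have "int N < \<bar>x - (a * M + int i * M)\<bar> + \<rho>" "int N < \<bar>x - (c * M - int i * M)\<bar> + \<rho>"
    using p by (simp_all add: distrib_right left_diff_distrib)
  then have "int N < x - (a * M + (t - int q0 * M)) + 2 * M"
    "int N < c * M - (t - int q0 * M) - x + 2 * M"
    using in_void t p by linarith+
  with \<open>int N < t - int q0 * M + 2 * M\<close> show "int N < t - int q0 * 2 ^ m + 2 * 2 ^ m"
    "int N < x - (a * 2 ^ m + (t - int q0 * 2 ^ m)) + 2 * 2 ^ m"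
    "int N < c * 2 ^ m - (t - int q0 * 2 ^ m) - x + 2 * 2 ^ m"
    by (simp_all add: M_def)
qed

text \<open>Each bounded component lies in one dilated zero triangle. There \<open>void_row\<close>
  and \<open>void_evolution\<close> identify the configuration with a translate of the reference
  evolution, late enough for it to have become the ether.\<close>

lemma replicator_if_confined:
  assumes f: "web_CA f" "compliant dg f" and conf: "confined dg m L (\<lambda>x. s x = 1)"
    and seed: "(\<lambda>x. s x = 1) \<in> seeds L"
    and ether: "ether \<eta>" "\<And>j x. 27 ^ (2 ^ m) + 2 ^ m \<le> j \<Longrightarrow>
      reference f m L (\<lambda>x. s x = 1) j x = \<eta> (x, int j)"
  shows "replicator (real (thickness m + L)) \<eta> (evolve f s)"
  unfolding replicator_def
proof (intro conjI ballI impI)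
  let ?N = "thickness m + L"
  let ?S = "- \<Lambda>_nbhd (real ?N)"
  define M :: int where "M = 2 ^ m"
  have M: "M \<ge> 2"
    using conf power_increasing[of 1 m "2::int"] by (simp add: confined_def M_def)
  have N: "int ?N = 27 ^ (2 ^ m) + 8 * M + int L" by (simp add: thickness_def M_def)
  have N_ge: "int ?N \<ge> 8 * M + int L" unfolding N by simp
  then have N8: "8 * 2 ^ m \<le> int ?N" by (simp add: M_def)
  show "ether \<eta>" by fact
  fix K assume K: "K \<in> nn_components ?S" "bounded_lattice_set K"
  obtain x0 t0 where z0: "(x0, t0) \<in> K" using component_nonempty[OF K(1)] by fastforce
  have "(x0, t0) \<in> ?S" using component_subset[OF K(1)] z0 by blast
  then obtain q0 a c where v: "1 \<le> q0" "a + 1 < c" "single q0 a" "single q0 c"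
    "\<And>y. a < y \<Longrightarrow> y < c \<Longrightarrow> \<not> single q0 y" "\<exists>y. a \<le> y \<and> y \<le> c \<and> single (q0 - 1) y"
    "(x0, t0) \<in> void m q0 a c"
    using bounded_component_in_cone[OF K z0] N8 by (rule component_meets_void) blast
  obtain y0 where y0: "a \<le> y0" "y0 \<le> c" "single (q0 - 1) y0" using v(6) by blast
  have rec: "single (q0 - 1) (y + 1) = (single (q0 - 1) y \<noteq> single (q0 - 1) (y - 1))"
    if "a < y" "y < c" for y
    using v(5)[OF that] T_Suc[of "q0 - 1" "\<lambda>y. y = 0" y] v(1) by auto
  obtain \<phi> where \<phi>: "\<And>y. a \<le> y \<Longrightarrow> y \<le> c \<Longrightarrow> single (q0 - 1) y = ((y - \<phi>) mod 3 \<noteq> 2)"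
    using void_pattern[of a c "single (q0 - 1)" y0, OF rec y0] by blast
  have margin: "int ?N < t - int q0 * M + 2 * M"
    "int ?N < x - (a * M + (t - int q0 * M)) + 2 * M"
    "int ?N < c * M - (t - int q0 * M) - x + 2 * M"
    if "(x, t) \<in> ?S" "(x, t) \<in> void m q0 a c" for x t
    unfolding M_def
    by (rule void_margin[where a = a and c = c and \<phi> = \<phi>, OF v(1-4) _ _ that]; (rule v(5) \<phi>; assumption))+
  \<comment> \<open>Points of the component are more than \<open>6 * M\<close> away from each side
    of the triangle, so a nearest-neighbour step cannot leave it.\<close>
  have void: "z \<in> void m q0 a c" if "z \<in> K" for z
    using K(1) z0 that
  proof (induction rule: component_induct)
    case base
    show ?case by (rule v(7))
  next
    case (step z z')
    obtain x t x' t' where z: "z = (x, t)" "z' = (x', t')" by (metis surj_pair)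
    have "\<bar>x - x'\<bar> + \<bar>t - t'\<bar> = 1" using step(4) by (simp add: z l1_dist_def)
    moreover note margin[OF step(2)[unfolded z] step(1)[unfolded z]]
    ultimately show ?case
      using N_ge M unfolding z void_def M_def[symmetric] by auto
  qed
  \<comment> \<open>One coarse step before the base, where \<open>void_pattern\<close> describes the
    coarse row.\<close>
  define t1 where "t1 = (q0 - 1) * 2 ^ m"
  have t1: "int t1 = int q0 * M - M"
    using v(1) by (simp add: t1_def M_def of_nat_diff left_diff_distrib)
  have "0 \<le> int t1" by simp
  have row: "(evolve f s t1 x = 1) = row m L (\<lambda>x. s x = 1) (x + - (\<phi> * M))"
    if "a * M + int L \<le> x" "x \<le> c * M" for x
    unfolding evolve_eq_1_iff[OF f(1)] t1_def M_def
    by (rule void_row[OF seed \<phi>]) (use that in \<open>auto simp: M_def\<close>)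
  define \<eta>' where "\<eta>' = (\<lambda>(x, t). \<eta> (x + - (\<phi> * M), t + - int t1))"
  have filled: "evolve f s (nat t) x = \<eta>' (x, t) \<and> 0 \<le> t" if "(x, t) \<in> K" for x t
  proof -
    have "(x, t) \<in> ?S" using component_subset[OF K(1)] that by blast
    note margin = margin[OF this void[OF that]]
    define j where "j = nat (t - int t1)"
    have j: "int j = t - int q0 * M + M"
      using margin(1) N_ge t1 M by (simp add: j_def)
    have t: "nat t = t1 + j" "0 \<le> t" using j t1 \<open>0 \<le> int t1\<close> M margin(1) N_ge by linarith+
    have "int (27 ^ (2 ^ m) + 2 ^ m) = 27 ^ (2 ^ m) + M" by (simp add: M_def)
    also have "\<dots> \<le> int j" using margin(1) N M j by linarith
    finally have j_ge: "27 ^ (2 ^ m) + 2 ^ m \<le> j" by (simp only: of_nat_le_iff)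
    have "evolve f s (nat t) x = evolve f (evolve f s t1) j x"
      by (simp add: t evolve_add)
    also have "\<dots> = reference f m L (\<lambda>x. s x = 1) j (x + - (\<phi> * M))"
      by (rule void_evolution[OF f conf, where lo = "a * M + int L" and hi = "c * M", OF row])
        (use j_ge j margin N_ge M in \<open>simp_all add: M_def[symmetric]\<close>)
    also have "\<dots> = \<eta> (x + - (\<phi> * M), int j)"
      by (rule ether(2)) (rule j_ge)
    also have "int j = t + - int t1" using j t1 by simp
    finally show ?thesis using t(2) by (simp add: \<eta>'_def)
  qed
  have "ether \<eta>'"
    unfolding ether_def
  proof (intro conjI)
    show "range \<eta>' \<subseteq> {0, 2}" using ether(1) by (auto simp: ether_def \<eta>'_def)
    obtain p where "p > 0" "\<And>x t. \<eta> (x + p, t) = \<eta> (x, t)" using ether(1) by (auto simp: ether_def)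
    from this(1) this(2)[of "_ + - (\<phi> * M)"] show "\<exists>p>0. \<forall>x t. \<eta>' (x + p, t) = \<eta>' (x, t)"
      by (intro exI[of _ p]) (simp add: \<eta>'_def algebra_simps)
    obtain p where "p > 0" "\<And>x t. \<eta> (x, t + p) = \<eta> (x, t)" using ether(1) by (auto simp: ether_def)
    from this(1) this(2)[of _ "_ + - int t1"] show "\<exists>p>0. \<forall>x t. \<eta>' (x, t + p) = \<eta>' (x, t)"
      by (intro exI[of _ p]) (simp add: \<eta>'_def algebra_simps)
  qed
  moreover have "ether_equiv \<eta> \<eta>'"
    unfolding ether_equiv_def \<eta>'_def
    by (intro exI[of _ "- (\<phi> * M)"] exI[of _ "- int t1"]) simp
  ultimately show "filled (evolve f s) \<eta> K"
    unfolding filled_def using filled by fast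
qed

section \<open>Random seeds\<close>

lemma map_random_binary_seed:
  "map_pmf (\<lambda>s x. s x = 1) (random_binary_seed L) = pmf_of_set (seeds L)"
  and set_random_binary_seed: "s \<in> set_pmf (random_binary_seed L) \<Longrightarrow> (\<lambda>x. s x = 1) \<in> seeds L"
proof -
  let ?D = "PiE_dflt {0..int L} (0::state) (\<lambda>_. {0, 1})"
  let ?g = "\<lambda>(s :: int \<Rightarrow> state) x. s x = 1"
  have pmf: "random_binary_seed L = pmf_of_set ?D"
    unfolding random_binary_seed_def by (rule Pi_pmf_of_set) auto
  have fin: "finite ?D" by (rule finite_PiE_dflt) auto
  have "(\<lambda>_. 0) \<in> ?D" by (auto simp: PiE_dflt_def)
  then have ne: "?D \<noteq> {}" by blast
  have "inj_on ?g ?D"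
  proof (rule inj_onI, rule ext)
    fix s s' x assume *: "s \<in> ?D" "s' \<in> ?D" "?g s = ?g s'"
    then have "(s x = 1) = (s' x = 1)" by meson
    with *(1,2) show "s x = s' x"
      by (cases "x \<in> {0..int L}") (fastforce simp: PiE_dflt_def)+
  qed
  moreover have image: "?g ` ?D = seeds L"
  proof (intro equalityI subsetI)
    fix b assume "b \<in> seeds L"
    then show "b \<in> ?g ` ?D"
      by (intro image_eqI[of _ _ "\<lambda>x. of_bool (b x)"]) (auto simp: PiE_dflt_def seeds_def)
  next
    fix b assume "b \<in> ?g ` ?D"
    then obtain s where s: "s \<in> ?D" "b = ?g s" by blast
    have "s x = 0" if "x \<notin> {0..int L}" for x
      using s(1) that by (auto simp: PiE_dflt_def)
    then have "x \<in> {0..int L}" if "b x" for x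
      using s(2) that state_distinct(1) by metis
    then show "b \<in> seeds L" by (simp add: seeds_def)
  qed
  ultimately show "map_pmf ?g (random_binary_seed L) = pmf_of_set (seeds L)"
    unfolding pmf using map_pmf_of_set_inj[OF _ ne fin] by metis
  show "?g s \<in> seeds L" if "s \<in> set_pmf (random_binary_seed L)"
    using that image unfolding pmf set_pmf_of_set[OF ne fin] by blast
qed

lemma seeds_nonempty: "seeds L \<noteq> {}"
proof -
  have "(\<lambda>_. False) \<in> seeds L" by (simp add: seeds_def)
  then show ?thesis by blast
qed

lemma prob_random_binary_seed:
  "measure_pmf.prob (random_binary_seed L) {s. Q (\<lambda>x. s x = 1)} =
    card {b \<in> seeds L. Q b} / card (seeds L)"
proof -
  have "card {b \<in> seeds L. Q b} / card (seeds L) = measure_pmf.prob (pmf_of_set (seeds L)) {b. Q b}"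
    by (simp add: measure_pmf_of_set[OF seeds_nonempty finite_seeds] Int_def)
  also have "\<dots> = measure_pmf.prob (random_binary_seed L) ((\<lambda>s x. s x = 1) -` {b. Q b})"
    unfolding map_random_binary_seed[symmetric] by (rule measure_map_pmf)
  finally show ?thesis by (simp add: vimage_def)
qed

section \<open>Tightness of the excess thickness\<close>

definition failure_bound :: "nat \<Rightarrow> real" where
  "failure_bound m = (7 / 8) ^ (2 ^ m - 2) * (252 * 2 ^ m)"

lemma prob_not_confined:
  assumes "2 * 2 ^ m \<le> L" "m \<ge> 1"
  shows "measure_pmf.prob (random_binary_seed L) {s. \<not> confined dg m L (\<lambda>x. s x = 1)} \<le> failure_bound m"
proof -
  have "int (2 * 2 ^ m) \<le> int L" using assms(1) by (simp only: of_nat_le_iff)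
  then have "2 * 2 ^ m \<le> int L + 1" by simp
  from card_not_confined[OF this assms(2), of dg]
  have bound: "real (card {b \<in> seeds L. \<not> confined dg m L b}) \<le> failure_bound m * real (card (seeds L))"
    by (simp only: failure_bound_def)
  have "0 < real (card (seeds L))" using seeds_nonempty finite_seeds by (simp add: card_gt_0_iff)
  then show ?thesis
    using prob_random_binary_seed[of L "\<lambda>b. \<not> confined dg m L b"] bound
    by (simp only: pos_divide_le_eq)
qed

text \<open>The sequence \<open>n * (7 / 8) ^ n\<close> along \<open>n = 2 ^ m\<close>; the factor
  64/49 makes up for the exponent being smaller by 2.\<close>

lemma failure_bound_tendsto_0: "failure_bound \<longlonglongrightarrow> 0"
proof -
  have "(\<lambda>n. real n * (7 / 8) ^ n) \<longlonglongrightarrow> 0"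
    by (rule powser_times_n_limit_0) simp
  moreover have "strict_mono (\<lambda>m. 2 ^ m :: nat)" by (simp add: strict_mono_def)
  ultimately have "((\<lambda>n. real n * (7 / 8) ^ n) \<circ> (\<lambda>m. 2 ^ m :: nat)) \<longlonglongrightarrow> 0"
    by (rule LIMSEQ_subseq_LIMSEQ)
  then have "(\<lambda>m. 252 * (64 / 49) * (real (2 ^ m) * (7 / 8) ^ (2 ^ m))) \<longlonglongrightarrow> 0"
    unfolding o_def by (intro tendsto_mult_right_zero)
  moreover have "252 * (64 / 49) * (real (2 ^ m) * (7 / 8) ^ (2 ^ m)) = failure_bound m" if "m \<ge> 1" for m
  proof -
    have "(2::nat) ^ m = (2 ^ m - 2) + 2"
      using power_increasing[OF that, of "2::nat"] by simp
    then have "(7 / 8 :: real) ^ (2 ^ m) = (7 / 8) ^ ((2 ^ m - 2) + 2)" by simp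
    also have "\<dots> = (7 / 8) ^ (2 ^ m - 2) * (49 / 64)"
      by (simp only: power_add) (simp add: power2_eq_square)
    finally show ?thesis by (simp add: failure_bound_def)
  qed
  then have "eventually (\<lambda>m. 252 * (64 / 49) * (real (2 ^ m) * (7 / 8) ^ (2 ^ m)) = failure_bound m) sequentially"
    by (auto simp: eventually_sequentially)
  ultimately show ?thesis
    by (rule Lim_transform_eventually)
qed

lemma failure_bound_less:
  assumes "0 < e"
  obtains m where "m \<ge> 1" "failure_bound m < e"
proof -
  have "eventually (\<lambda>m. failure_bound m < e \<and> 1 \<le> m) sequentially"
    by (intro eventually_conj order_tendstoD(2)[OF failure_bound_tendsto_0 assms] eventually_ge_at_top)
  then have "\<exists>m. failure_bound m < e \<and> 1 \<le> m"
    by (rule eventually_happens'[OF sequentially_bot])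
  then show thesis using that by blast
qed

lemma thickness_mono: "m \<le> n \<Longrightarrow> thickness m \<le> thickness n"
  unfolding thickness_def by (intro add_mono mult_left_mono power_increasing) auto

text \<open>This is the random variable of the theorem: the thickness at the smallest scale where no
  influence path survives. It reads the seed only through the positions of its 1s.\<close>

definition excess :: "bool \<Rightarrow> nat \<Rightarrow> (int \<Rightarrow> state) \<Rightarrow> ennreal" where
  "excess dg L s = (if \<exists>m. confined dg m L (\<lambda>x. s x = 1)
    then ennreal (real (thickness (LEAST m. confined dg m L (\<lambda>x. s x = 1)))) else \<infinity>)"

lemma excess_le:
  assumes "confined dg m L (\<lambda>x. s x = 1)"
  shows "excess dg L s \<le> ennreal (real (thickness m))"
proof -
  have "(LEAST m. confined dg m L (\<lambda>x. s x = 1)) \<le> m" using assms by (rule Least_le)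
  with assms show ?thesis
    by (auto simp: excess_def intro!: ennreal_leI thickness_mono)
qed

lemma prob_excess_greater:
  assumes "2 * 2 ^ m \<le> L" "m \<ge> 1" "ennreal (real (thickness m)) \<le> B"
  shows "measure_pmf.prob (random_binary_seed L) {s. excess dg L s > B} \<le> failure_bound m"
proof -
  have "{s. excess dg L s > B} \<subseteq> {s. \<not> confined dg m L (\<lambda>x. s x = 1)}"
    using order_trans[OF excess_le assms(3)] by (auto simp: not_less[symmetric])
  then have "measure_pmf.prob (random_binary_seed L) {s. excess dg L s > B} \<le>
      measure_pmf.prob (random_binary_seed L) {s. \<not> confined dg m L (\<lambda>x. s x = 1)}"
    by (rule measure_pmf.finite_measure_mono) simp
  also have "\<dots> \<le> failure_bound m" by (rule prob_not_confined[OF assms(1,2)])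
  finally show ?thesis .
qed

text \<open>For a fixed scale \<open>m\<close> the bound \<open>failure_bound m\<close> is uniform
  in all \<open>L \<ge> 2 * 2 ^ m\<close>, so \<open>m\<close> is fixed first according to
  \<open>e\<close>. Tightness follows in the same way.\<close>

lemma prob_excess_infinite: "(\<lambda>L. measure_pmf.prob (random_binary_seed L) {s. excess dg L s = \<infinity>}) \<longlonglongrightarrow> 0"
proof (rule order_tendstoI)
  fix e :: real assume "0 < e"
  then obtain m where m: "m \<ge> 1" "failure_bound m < e" by (rule failure_bound_less)
  have "measure_pmf.prob (random_binary_seed L) {s. excess dg L s = \<infinity>} < e" if "2 * 2 ^ m \<le> L" for L
  proof -
    have "measure_pmf.prob (random_binary_seed L) {s. excess dg L s = \<infinity>} \<le>
        measure_pmf.prob (random_binary_seed L) {s. excess dg L s > ennreal (real (thickness m))}"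
      by (rule measure_pmf.finite_measure_mono) (auto simp: infinity_ennreal_def)
    also have "\<dots> \<le> failure_bound m" by (rule prob_excess_greater[OF that m(1)]) simp
    finally show ?thesis using m(2) by simp
  qed
  then show "eventually (\<lambda>L. measure_pmf.prob (random_binary_seed L) {s. excess dg L s = \<infinity>} < e) sequentially"
    by (auto simp: eventually_sequentially)
next
  fix e :: real assume "e < 0"
  then show "eventually (\<lambda>L. e < measure_pmf.prob (random_binary_seed L) {s. excess dg L s = \<infinity>}) sequentially"
    by (intro always_eventually allI) (meson less_le_trans measure_nonneg)
qed

lemma tight_excess: "tight_seq random_binary_seed (excess dg)"
  unfolding tight_seq_def
proof (rule order_tendstoI)
  let ?p = "\<lambda>\<rho> L. ereal (measure_pmf.prob (random_binary_seed L) {s. excess dg L s > ennreal \<rho>})"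
  fix e :: ereal assume "0 < e"
  then obtain e' :: real where e': "0 < e'" "ereal e' < e"
    by (metis ereal_dense2 ereal_less(2))
  obtain m where m: "m \<ge> 1" "failure_bound m < e'" using e'(1) by (rule failure_bound_less)
  have "limsup (?p \<rho>) < e" if "real (thickness m) \<le> \<rho>" for \<rho>
  proof -
    have "eventually (\<lambda>L. ?p \<rho> L \<le> ereal (failure_bound m)) sequentially"
      unfolding eventually_sequentially
    proof (intro exI allI impI)
      fix L :: nat assume "2 * 2 ^ m \<le> L"
      then show "?p \<rho> L \<le> ereal (failure_bound m)"
        using prob_excess_greater[OF _ m(1), of L "ennreal \<rho>" dg] that by (simp add: ennreal_leI)
    qed
    then have "limsup (?p \<rho>) \<le> ereal (failure_bound m)" by (rule Limsup_bounded)
    also have "\<dots> < ereal e'" using m(2) by simp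
    finally show ?thesis using e'(2) by simp
  qed
  then show "eventually (\<lambda>\<rho>. limsup (?p \<rho>) < e) at_top"
    by (auto simp: eventually_at_top_linorder)
next
  let ?p = "\<lambda>\<rho> L. ereal (measure_pmf.prob (random_binary_seed L) {s. excess dg L s > ennreal \<rho>})"
  fix e :: ereal assume "e < 0"
  moreover have "0 \<le> limsup (?p \<rho>)" for \<rho>
    by (rule le_Limsup) auto
  ultimately show "eventually (\<lambda>\<rho>. e < limsup (?p \<rho>)) at_top"
    by (intro always_eventually allI) (rule less_le_trans)
qed

text \<open>The choice is made from the positions of the 1s alone, at the same scale as in
  \<open>excess\<close>. The constant 0 is the default that makes the value an ether for every
  seed.\<close>

definition seed_ether :: "rule \<Rightarrow> bool \<Rightarrow> nat \<Rightarrow> (int \<Rightarrow> bool) \<Rightarrow> int \<times> int \<Rightarrow> state" where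
  "seed_ether f dg L b = (if \<exists>m. confined dg m L b
    then let m = LEAST m. confined dg m L b in
      SOME \<eta>. ether \<eta> \<and> (\<forall>j\<ge>27 ^ (2 ^ m) + 2 ^ m. \<forall>x. reference f m L b j x = \<eta> (x, int j))
    else (\<lambda>_. 0))"

lemma seed_ether:
  assumes "web_CA f"
  shows "ether (seed_ether f dg L b)"
    and "\<exists>m. confined dg m L b \<Longrightarrow> m = (LEAST m. confined dg m L b) \<Longrightarrow>
      27 ^ (2 ^ m) + 2 ^ m \<le> j \<Longrightarrow> reference f m L b j x = seed_ether f dg L b (x, int j)"
proof -
  have *: "ether (seed_ether f dg L b) \<and>
    (\<forall>j\<ge>27 ^ (2 ^ m) + 2 ^ m. \<forall>x. reference f m L b j x = seed_ether f dg L b (x, int j))"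
    if "\<exists>m. confined dg m L b" "m = (LEAST m. confined dg m L b)" for m
  proof -
    let ?P = "\<lambda>\<eta>. ether \<eta> \<and> (\<forall>j\<ge>27 ^ (2 ^ m) + 2 ^ m. \<forall>x. reference f m L b j x = \<eta> (x, int j))"
    have ex: "\<exists>\<eta>. ?P \<eta>"
      by (rule reference_ether[OF assms]) blast
    have eq: "seed_ether f dg L b = (SOME \<eta>. ?P \<eta>)"
      unfolding seed_ether_def Let_def that(2)[symmetric] if_P[OF that(1)] ..
    show ?thesis unfolding eq by (rule someI_ex[of ?P, OF ex])
  qed
  then show "\<exists>m. confined dg m L b \<Longrightarrow> m = (LEAST m. confined dg m L b) \<Longrightarrow>
      27 ^ (2 ^ m) + 2 ^ m \<le> j \<Longrightarrow> reference f m L b j x = seed_ether f dg L b (x, int j)"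
    by blast
  show "ether (seed_ether f dg L b)"
  proof (cases "\<exists>m. confined dg m L b")
    case True
    with * show ?thesis by blast
  next
    case False
    have "ether (\<lambda>_. 0)" by (auto simp: ether_def intro: exI[of _ 1])
    with False show ?thesis by (simp add: seed_ether_def)
  qed
qed

lemma replicator_if_excess_finite:
  assumes "web_CA f" "compliant dg f" "(\<lambda>x. s x = 1) \<in> seeds L" "excess dg L s < \<infinity>"
  shows "replicator (enn2real (excess dg L s) + real L) (seed_ether f dg L (\<lambda>x. s x = 1)) (evolve f s)"
proof -
  let ?b = "\<lambda>x. s x = 1"
  define m where "m = (LEAST m. confined dg m L ?b)"
  have ex: "\<exists>m. confined dg m L ?b"
    using assms(4) by (auto simp: excess_def split: if_splits)
  then have conf: "confined dg m L ?b" unfolding m_def by (rule LeastI_ex)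
  have "enn2real (excess dg L s) + real L = real (thickness m + L)"
    using ex by (simp add: excess_def m_def)
  then show ?thesis
    using replicator_if_confined[OF assms(1,2) conf assms(3) seed_ether(1)[OF assms(1)]
        seed_ether(2)[OF assms(1) ex m_def]] by simp
qed

theorem theorem1p1:
  fixes f :: rule
  assumes "web_CA f"
    and "diagonal_compliant f \<or> wide_compliant f"
  shows "\<exists>(R :: nat \<Rightarrow> (int \<Rightarrow> state) \<Rightarrow> ennreal) (\<eta> :: nat \<Rightarrow> (int \<Rightarrow> state) \<Rightarrow> int \<times> int \<Rightarrow> state).
    (\<forall>L. \<forall>s \<in> set_pmf (random_binary_seed L). ether (\<eta> L s)) \<and>
    (\<lambda>L. measure_pmf.prob (random_binary_seed L) {s. R L s = \<infinity>}) \<longlonglongrightarrow> 0 \<and>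
    tight_seq random_binary_seed R \<and>
    (\<forall>L. \<forall>s \<in> set_pmf (random_binary_seed L). R L s < \<infinity> \<longrightarrow>
      replicator (enn2real (R L s) + real L) (\<eta> L s) (evolve f s)) \<and>
    (\<forall>L. \<forall>s \<in> set_pmf (random_binary_seed L). R L s < \<infinity> \<longrightarrow>
      (\<forall>A. finite A \<and> A \<subseteq> {x. s x = 0} \<longrightarrow>
        replicator (enn2real (R L s) + real L) (\<eta> L s)
          (evolve f (\<lambda>x. if x \<in> A then 2 else s x))))"
proof -
  obtain dg where dg: "compliant dg f"
    using assms(2) unfolding compliant_def by (metis (full_types))
  let ?\<eta> = "\<lambda>L s. seed_ether f dg L (\<lambda>x. s x = 1)"
  \<comment> \<open>Turning 0s into 2s keeps the 1s, hence both \<open>excess\<close> and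
    \<open>seed_ether\<close>, and \<open>replicator_if_excess_finite\<close> also applies to seeds
    containing 2s.\<close>
  have recoloured: "replicator (enn2real (excess dg L s) + real L) (?\<eta> L s)
      (evolve f (\<lambda>x. if x \<in> A then 2 else s x))"
    if s: "s \<in> set_pmf (random_binary_seed L)" "excess dg L s < \<infinity>" and A: "A \<subseteq> {x. s x = 0}" for L s A
  proof -
    have same: "(\<lambda>x. (if x \<in> A then 2 else s x) = 1) = (\<lambda>x. s x = 1)"
    proof (rule ext)
      show "((if x \<in> A then 2 else s x) = 1) = (s x = 1)" for x
        using A by (cases "x \<in> A") auto
    qed
    then have "excess dg L (\<lambda>x. if x \<in> A then 2 else s x) = excess dg L s"
      by (simp only: excess_def)
    with replicator_if_excess_finite[OF assms(1) dg, of "\<lambda>x. if x \<in> A then 2 else s x" L]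
    show ?thesis
      using s set_random_binary_seed[OF s(1)] by (simp only: same)
  qed
  show ?thesis
    by (intro exI[of _ "excess dg"] exI[of _ ?\<eta>] conjI allI ballI impI seed_ether(1) assms(1)
        prob_excess_infinite tight_excess replicator_if_excess_finite dg set_random_binary_seed recoloured)
      auto
qed

end
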